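(* Assume that $u_0$ satisfies one of the following hypotheses: $(\mathbf{H_1})$ $u_0\in L^\infty(\Omega)$, $u_0\ge1$ a.e. in $\Omega$, $u_0\not\equiv1$; $(\mathbf{H_2})$ $u_0\in L^\infty(\Omega)$, $0\le u_0\le1$ a.e. in $\Omega$, $\int_\Omega g(u_0(x))\,dx\ne0$; $(\mathbf{H_3})$ $u_0\in L^\infty(\Omega)$, $u_0\le0$ a.e. in $\Omega$, $u_0\not\equiv0$. Let $\varphi\in\omega(u_0)$. Then (identities and inequalities holding a.e. in $\Omega$, and all sets being measurable): (i) If $(\mathbf{H_1})$ holds, then $1\le\varphi\le\operatorname{ess\,sup}_\Omega u_0$ and $\varphi$ is a step function: $\varphi=\mu\chi_{A_1}+\chi_{\Omega\setminus A_1}$ for some $\mu>1$ and $A_1\subset\Omega$ with $|A_1|\ne0$. (ii) If $(\mathbf{H_2})$ holds, then $0\le\varphi\le1$ and $\varphi$ is a step function: $\varphi=\chi_{A_1}+\nu\chi_{A_2}$ for some $0<\nu<1$ and $A_1,A_2\subset\Omega$ with $A_1\cup A_2\subset\Omega$ and $A_1\cap A_2=\emptyset$. (iii) If $(\mathbf{H_3})$ holds, then $\operatorname{ess\,inf}_\Omega u_0\le\varphi\le0$ and $\varphi$ is a step function: $\varphi=\xi\chi_{A_1}$ for some $\xi<0$ and $A_1\subset\Omega$ with $|A_1|\ne0$.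
   Context: Standing assumptions: $\Omega\subset\mathbb{R}^N$ ($N\ge1$) is an open bounded set; $p\in C^1(\mathbb{R})$ is strictly increasing on $\mathbb{R}$; $g\in C^1(\mathbb{R})$ satisfies $g(0)=g(1)=0$, $g>0$ on $(0,1)$ and $g<0$ on $(-\infty,0)\cup(1,\infty)$. For $v\in L^\infty(\Omega)$ with $\int_\Omega g(v)\ne0$ put $F(v):=g(v)p(v)-g(v)\dfrac{\int_\Omega g(v)p(v)}{\int_\Omega g(v)}$. Problem $(P)$ is the initial value problem $u_t=F(u)$, $t\ge0$, $u(x,0)=u_0(x)$, $x\in\Omega$. For $0<T\le\infty$, a function $u\in C^1([0,T);L^\infty(\Omega))$ is a solution of $(P)$ on $[0,T)$ if $u(0)=u_0$, $\int_\Omega g(u(t))\ne0$ for all $t\in[0,T)$, and $\frac{du}{dt}=F(u)$ on the whole interval $[0,T)$. Under any of $(\mathbf{H_1})$, $(\mathbf{H_2})$, $(\mathbf{H_3})$, Problem $(P)$ has a unique solution $u$ on $[0,\infty)$, and the $\omega$-limit set is $\omega(u_0):=\{\varphi\in L^1(\Omega):\exists\, t_n\to\infty,\ u(t_n)\to\varphi \text{ in } L^1(\Omega)\text{ as } n\to\infty\}$. $\chi_A$ denotes the characteristic function of $A$ and $|A|$ its Lebesgue measure. *)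

theory Defs
  imports "HOL-Analysis.Analysis" "HOL-Probability.Essential_Supremum"
begin

text \<open>
  Elements of \<open>L\<^sup>\<infinity>(\<Omega>)\<close> and \<open>L\<^sup>1(\<Omega>)\<close> are represented by functions; equality in these spaces is
  equality almost everywhere with respect to \<^term>\<open>lebesgue_on \<Omega>\<close>.
\<close>

definition Linf :: "'a measure \<Rightarrow> ('a \<Rightarrow> real) set" where
  "Linf M = {f \<in> borel_measurable M. esssup M (\<lambda>x. ereal \<bar>f x\<bar>) < \<infinity>}"

text \<open>Only meaningful on \<^const>\<open>Linf\<close>. On a null space \<^const>\<open>esssup\<close> is \<open>-\<infinity>\<close>, which
  \<^const>\<open>real_of_ereal\<close> sends to the correct value \<open>0\<close>.\<close>

definition Linf_norm :: "'a measure \<Rightarrow> ('a \<Rightarrow> real) \<Rightarrow> real" where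
  "Linf_norm M f = real_of_ereal (esssup M (\<lambda>x. ereal \<bar>f x\<bar>))"

definition essinf :: "'a measure \<Rightarrow> ('a \<Rightarrow> ereal) \<Rightarrow> ereal" where
  "essinf M f = - esssup M (\<lambda>x. - f x)"

text \<open>Derivative along \<open>I\<close> in the Banach space \<open>L\<^sup>\<infinity>\<close>: the difference quotients converge in norm
  (one-sidedly at an endpoint of \<open>I\<close>).\<close>

definition has_Linf_derivative ::
  "'a measure \<Rightarrow> (real \<Rightarrow> 'a \<Rightarrow> real) \<Rightarrow> ('a \<Rightarrow> real) \<Rightarrow> real \<Rightarrow> real set \<Rightarrow> bool" where
  "has_Linf_derivative M u w t I \<longleftrightarrow>
     w \<in> Linf M \<and>
     ((\<lambda>s. Linf_norm M (\<lambda>x. (u s x - u t x) / (s - t) - w x)) \<longlongrightarrow> 0) (at t within I)"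

definition continuous_on_Linf :: "'a measure \<Rightarrow> real set \<Rightarrow> (real \<Rightarrow> 'a \<Rightarrow> real) \<Rightarrow> bool" where
  "continuous_on_Linf M I w \<longleftrightarrow>
     (\<forall>t\<in>I. w t \<in> Linf M) \<and>
     (\<forall>t\<in>I. ((\<lambda>s. Linf_norm M (\<lambda>x. w s x - w t x)) \<longlongrightarrow> 0) (at t within I))"

definition C1_Linf :: "'a measure \<Rightarrow> real set \<Rightarrow> (real \<Rightarrow> 'a \<Rightarrow> real) \<Rightarrow> bool" where
  "C1_Linf M I u \<longleftrightarrow>
     (\<forall>t\<in>I. u t \<in> Linf M) \<and>
     (\<exists>w. (\<forall>t\<in>I. has_Linf_derivative M u (w t) t I) \<and> continuous_on_Linf M I w)"

definition nonlocal_F ::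
  "'a::euclidean_space set \<Rightarrow> (real \<Rightarrow> real) \<Rightarrow> (real \<Rightarrow> real) \<Rightarrow> ('a \<Rightarrow> real) \<Rightarrow> 'a \<Rightarrow> real" where
  "nonlocal_F \<Omega> g p v = (\<lambda>x. g (v x) * p (v x) -
     g (v x) * ((LINT y|lebesgue_on \<Omega>. g (v y) * p (v y)) / (LINT y|lebesgue_on \<Omega>. g (v y))))"

definition solution_P ::
  "'a::euclidean_space set \<Rightarrow> (real \<Rightarrow> real) \<Rightarrow> (real \<Rightarrow> real) \<Rightarrow> ('a \<Rightarrow> real) \<Rightarrow> ereal
    \<Rightarrow> (real \<Rightarrow> 'a \<Rightarrow> real) \<Rightarrow> bool" where
  "solution_P \<Omega> g p u0 T u \<longleftrightarrow>
     (let M = lebesgue_on \<Omega>; I = {t. 0 \<le> t \<and> ereal t < T} in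
       C1_Linf M I u \<and>
       (AE x in M. u 0 x = u0 x) \<and>
       (\<forall>t\<in>I. (LINT x|M. g (u t x)) \<noteq> 0) \<and>
       (\<forall>t\<in>I. has_Linf_derivative M u (nonlocal_F \<Omega> g p (u t)) t I))"

text \<open>The \<open>\<omega>\<close>-limit set of the trajectory \<open>u\<close>; when \<open>u\<close> is the solution of the problem on
  \<open>[0,\<infinity>)\<close> with initial value \<open>u0\<close>, this is \<open>\<omega>(u0)\<close>.\<close>

definition omega_limit ::
  "'a::euclidean_space set \<Rightarrow> (real \<Rightarrow> 'a \<Rightarrow> real) \<Rightarrow> ('a \<Rightarrow> real) set" where
  "omega_limit \<Omega> u = {\<phi>. integrable (lebesgue_on \<Omega>) \<phi> \<and>
     (\<exists>t. (\<forall>n. 0 \<le> t n) \<and> filterlim t at_top sequentially \<and>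
        (\<lambda>n. LINT x|lebesgue_on \<Omega>. \<bar>u (t n) x - \<phi> x\<bar>) \<longlonglongrightarrow> 0)}"

definition H1 :: "'a::euclidean_space set \<Rightarrow> ('a \<Rightarrow> real) \<Rightarrow> bool" where
  "H1 \<Omega> u0 \<longleftrightarrow> u0 \<in> Linf (lebesgue_on \<Omega>) \<and> (AE x in lebesgue_on \<Omega>. 1 \<le> u0 x) \<and>
     \<not> (AE x in lebesgue_on \<Omega>. u0 x = 1)"

definition H2 :: "'a::euclidean_space set \<Rightarrow> (real \<Rightarrow> real) \<Rightarrow> ('a \<Rightarrow> real) \<Rightarrow> bool" where
  "H2 \<Omega> g u0 \<longleftrightarrow> u0 \<in> Linf (lebesgue_on \<Omega>) \<and>
     (AE x in lebesgue_on \<Omega>. 0 \<le> u0 x \<and> u0 x \<le> 1) \<and>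
     (LINT x|lebesgue_on \<Omega>. g (u0 x)) \<noteq> 0"

definition H3 :: "'a::euclidean_space set \<Rightarrow> ('a \<Rightarrow> real) \<Rightarrow> bool" where
  "H3 \<Omega> u0 \<longleftrightarrow> u0 \<in> Linf (lebesgue_on \<Omega>) \<and> (AE x in lebesgue_on \<Omega>. u0 x \<le> 0) \<and>
     \<not> (AE x in lebesgue_on \<Omega>. u0 x = 0)"

end

theory Submission
  imports Defs
begin

text \<open>
  Write \<open>A\<close>, \<open>B\<close>, \<open>C\<close> for the integrals of \<open>g(u)\<close>, \<open>g(u) p(u)\<close>, \<open>g(u) p(u)\<^sup>2\<close> over \<open>\<Omega>\<close>. The equation
  \<open>u\<^sub>t = g(u) (p(u) - B/A)\<close> keeps the integral of \<open>u\<close> constant. Gronwall's inequality for the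
  integral of the squared excess over a level shows that the zeros of \<open>g\<close> are barriers and that,
  where \<open>g(u) \<le> 0\<close>, the extreme values of \<open>u\<^sub>0\<close> are barriers too. If \<open>P' = p\<close>, the time
  derivative of the integral of \<open>P(u)\<close> is the integral of \<open>g(u) (p(u) - B/A)\<^sup>2\<close>, i.e.
  \<open>(A C - B\<^sup>2) / A\<close>, which has a fixed sign and is integrable in time. As \<open>A C - B\<^sup>2\<close> is Lipschitz in time, even when \<open>A\<close> gets
  small, it vanishes on every limit \<open>\<phi>\<close>. So either \<open>g(\<phi>) = 0\<close>, or \<open>p(\<phi>)\<close> is a constant wherever
  \<open>g(\<phi>) \<noteq> 0\<close>, and \<open>p\<close> is injective. Conservation of mass excludes a constant limit \<open>1\<close>
  (resp. \<open>0\<close>) under \<open>H1\<close> (resp. \<open>H3\<close>).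
\<close>

section \<open>Calculus on the half-line\<close>

lemma continuous_bounded_on_Icc:
  fixes f :: "real \<Rightarrow> real"
  assumes "continuous_on UNIV f"
  shows "\<exists>C>0. \<forall>y\<in>{a..b}. \<bar>f y\<bar> \<le> C"
proof -
  have "compact (f ` {a..b})"
    by (intro compact_continuous_image continuous_on_subset[OF assms]) auto
  then obtain C where "C > 0" "\<forall>y\<in>f ` {a..b}. norm y \<le> C"
    using compact_imp_bounded bounded_pos by metis
  then show ?thesis by auto
qed

lemma C1_lipschitz_on_Icc:
  fixes h h' :: "real \<Rightarrow> real"
  assumes "\<And>y. (h has_real_derivative h' y) (at y)" "continuous_on UNIV h'"
  shows "\<exists>L>0. \<forall>x\<in>{a..b}. \<forall>y\<in>{a..b}. \<bar>h x - h y\<bar> \<le> L * \<bar>x - y\<bar>"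
proof -
  obtain L where L: "L > 0" "\<forall>y\<in>{a..b}. \<bar>h' y\<bar> \<le> L"
    using continuous_bounded_on_Icc[OF assms(2)] by blast
  have "\<bar>h x - h y\<bar> \<le> L * \<bar>x - y\<bar>" if "x \<in> {a..b}" "y \<in> {a..b}" for x y
    using field_differentiable_bound[of "{a..b}" h h' L x y] assms(1) L(2) that
    by (auto intro: DERIV_subset)
  with L(1) show ?thesis by blast
qed

text \<open>A radius \<open>d\<close> valid for all \<open>x\<close> in a bounded range is what
  allows a first-order expansion under an integral over \<open>x\<close>. Once
  \<open>\<bar>y - x\<bar> < 1\<close>, the segment from \<open>x\<close> to \<open>y\<close> lies
  in the compact interval \<open>{-R-1..R+1}\<close>, where \<open>h'\<close> is uniformly
  continuous; hence the function \<open>h z - h' x * z\<close> has slope at most \<open>e\<close>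
  along it.\<close>

lemma C1_uniform_expansion:
  fixes h h' :: "real \<Rightarrow> real"
  assumes der: "\<And>y. (h has_real_derivative h' y) (at y)" and cont: "continuous_on UNIV h'"
    and "e > 0"
  shows "\<exists>d>0. \<forall>x y. \<bar>x\<bar> \<le> R \<longrightarrow> \<bar>y - x\<bar> < d \<longrightarrow> \<bar>h y - h x - h' x * (y - x)\<bar> \<le> e * \<bar>y - x\<bar>"
proof -
  have "uniformly_continuous_on {-R-1..R+1} h'"
    by (intro compact_uniformly_continuous continuous_on_subset[OF cont]) auto
  then obtain d where d: "d > 0"
    "\<And>x y. \<lbrakk>x \<in> {-R-1..R+1}; y \<in> {-R-1..R+1}; dist y x < d\<rbrakk> \<Longrightarrow> dist (h' y) (h' x) < e"
    unfolding uniformly_continuous_on_def using \<open>e > 0\<close> by metis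
  have "\<bar>h y - h x - h' x * (y - x)\<bar> \<le> e * \<bar>y - x\<bar>"
    if x: "\<bar>x\<bar> \<le> R" and y: "\<bar>y - x\<bar> < min d 1" for x y
  proof -
    let ?S = "closed_segment x y"
    have bd: "norm (h' z - h' x) \<le> e" if "z \<in> ?S" for z
    proof -
      have "\<bar>z - x\<bar> \<le> \<bar>y - x\<bar>"
        using that by (auto simp: closed_segment_eq_real_ivl split: if_splits)
      then have "dist (h' z) (h' x) < e"
        using x y by (intro d(2)) (auto simp: dist_real_def)
      then show ?thesis by (simp add: dist_real_def)
    qed
    have "norm ((h y - h' x * y) - (h x - h' x * x)) \<le> e * norm (y - x)"
      by (rule field_differentiable_bound[where S = ?S and f' = "\<lambda>z. h' z - h' x"])
        (use bd in \<open>auto intro!: derivative_eq_intros DERIV_subset[OF der]\<close>)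
    then show ?thesis by (simp add: algebra_simps)
  qed
  with d(1) show ?thesis by (intro exI[of _ "min d 1"]) auto
qed

text \<open>Squaring removes the kink of the positive part: at 0 the difference quotient is bounded
  by \<open>\<bar>y\<bar>\<close>. So the squared excess over a level is an admissible integrand for
  the chain rule under the integral.\<close>

lemma pos_part_square_has_derivative:
  "((\<lambda>z. (max 0 z)\<^sup>2) has_real_derivative 2 * max 0 z) (at z)"
proof -
  consider "z > 0" | "z < 0" | "z = 0" by linarith
  then show ?thesis
  proof cases
    case 1
    have "((\<lambda>z. z\<^sup>2) has_real_derivative 2 * max 0 z) (at z)"
      using 1 by (auto intro!: derivative_eq_intros)
    then show ?thesis
      by (rule has_field_derivative_transform_within_open[OF _ open_greaterThan[of 0]]) (use 1 in auto)
  next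
    case 2
    have "((\<lambda>z. 0) has_real_derivative 2 * max 0 z) (at z)"
      using 2 by (auto intro!: derivative_eq_intros)
    then show ?thesis
      by (rule has_field_derivative_transform_within_open[OF _ open_lessThan[of 0]]) (use 2 in auto)
  next
    case 3
    have "((\<lambda>y :: real. (max 0 y)\<^sup>2 / y) \<longlongrightarrow> 0) (at 0)"
    proof (rule Lim_null_comparison)
      show "\<forall>\<^sub>F y in at 0. norm ((max 0 y)\<^sup>2 / y) \<le> \<bar>y :: real\<bar>"
        by (auto simp: max_def power2_eq_square)
      show "((\<lambda>y :: real. \<bar>y\<bar>) \<longlongrightarrow> 0) (at 0)"
        using tendsto_rabs[OF tendsto_ident_at[of "0 :: real" UNIV]] by simp
    qed
    then show ?thesis using 3 by (simp add: has_field_derivative_iff)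
  qed
qed

lemma nonincreasing_if_derivative_nonpos:
  fixes f f' :: "real \<Rightarrow> real"
  assumes "\<And>t. t \<ge> 0 \<Longrightarrow> (f has_real_derivative f' t) (at t within {0..})"
    and "0 \<le> a" "a \<le> b" and "\<And>t. \<lbrakk>a \<le> t; t \<le> b\<rbrakk> \<Longrightarrow> f' t \<le> 0"
  shows "f b \<le> f a"
proof -
  have "\<exists>x\<in>{a..b}. f b - f a = f' x * (b - a)"
    using assms(2,3) DERIV_subset[OF assms(1), of _ "{a..b}"]
    by (intro mvt_very_simple) (auto intro!: has_field_derivative_imp_has_derivative)
  then show ?thesis using assms(3,4) by (smt (verit) atLeastAtMost_iff mult_nonpos_nonneg)
qed

text \<open>With the integrating factor \<open>exp (- K * t)\<close> the function becomes
  nonincreasing on \<open>[0, T]\<close>; it starts at 0 and cannot be negative.\<close>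

lemma gronwall_zero:
  fixes E E' :: "real \<Rightarrow> real"
  assumes der: "\<And>t. t \<ge> 0 \<Longrightarrow> (E has_real_derivative E' t) (at t within {0..})"
    and "E 0 = 0" and "\<And>t. E t \<ge> 0" and "T \<ge> 0"
    and le: "\<And>t. \<lbrakk>0 \<le> t; t \<le> T\<rbrakk> \<Longrightarrow> E' t \<le> K * E t"
  shows "E T = 0"
proof -
  have "exp (- K * T) * E T \<le> exp (- K * 0) * E 0"
  proof (rule nonincreasing_if_derivative_nonpos
      [where f = "\<lambda>t. exp (- K * t) * E t" and f' = "\<lambda>t. exp (- K * t) * (E' t - K * E t)"])
    fix t :: real assume "t \<ge> 0"
    then show "((\<lambda>t. exp (- K * t) * E t) has_real_derivative exp (- K * t) * (E' t - K * E t))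
        (at t within {0..})"
      using der[of t] by (auto intro!: derivative_eq_intros simp: algebra_simps)
  qed (use assms in \<open>auto intro!: mult_nonneg_nonpos\<close>)
  then have "E T \<le> 0" using \<open>E 0 = 0\<close> by (simp add: mult_le_0_iff)
  with assms(3)[of T] show ?thesis by simp
qed

text \<open>On each interval \<open>[t n, t n + \<delta>]\<close> the bounded nondecreasing function \<open>E\<close> would otherwise gain a
  fixed amount.\<close>

lemma dissipation_tends_to_zero:
  fixes E E' Q :: "real \<Rightarrow> real"
  assumes der: "\<And>s. s \<ge> 0 \<Longrightarrow> (E has_real_derivative E' s) (at s within {0..})"
    and bdd: "\<And>s. s \<ge> 0 \<Longrightarrow> E s \<le> C"
    and dom: "\<And>s. s \<ge> 0 \<Longrightarrow> \<bar>Q s\<bar> \<le> K * E' s" and "K > 0"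
    and lip: "L-lipschitz_on {0..} Q"
    and t: "\<And>n. 0 \<le> t n" "filterlim t at_top sequentially"
    and lim: "(\<lambda>n. Q (t n)) \<longlonglongrightarrow> q"
  shows "q = 0"
proof (rule ccontr)
  assume "q \<noteq> 0"
  \<comment> \<open>Eventually \<open>\<bar>Q (t n)\<bar> > 2 * k\<close>, as its limit is
    \<open>4 * k\<close>. Over a time \<open>\<delta>\<close> the Lipschitz bound loses at most
    \<open>k\<close>, so \<open>\<bar>Q\<bar> \<ge> k\<close> on the whole window. The summand 1 in
    \<open>L + 1\<close> covers \<open>L = 0\<close>.\<close>
  define k where "k = \<bar>q\<bar> / 4"
  have k: "k > 0" using \<open>q \<noteq> 0\<close> by (simp add: k_def)
  define \<delta> where "\<delta> = k / (L + 1)"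
  have L: "L \<ge> 0" using lip by (rule lipschitz_on_nonneg)
  have \<delta>: "\<delta> > 0" "L * \<delta> \<le> k" using k L by (auto simp: \<delta>_def field_simps)
  have E'_nonneg: "E' s \<ge> 0" if "s \<ge> 0" for s
    using dom[OF that] \<open>K > 0\<close> abs_ge_zero[of "Q s"]
    by (smt (verit) zero_le_mult_iff)
  have mono: "E a \<le> E b" if "0 \<le> a" "a \<le> b" for a b
    using nonincreasing_if_derivative_nonpos[of "\<lambda>s. - E s" "\<lambda>s. - E' s" a b] that E'_nonneg
    by (auto intro!: derivative_eq_intros der)
  have ev: "\<forall>\<^sub>F n in sequentially. E (t n + \<delta>) - E (t n) \<ge> k / K * \<delta>"
  proof -
    have "(\<lambda>n. \<bar>Q (t n)\<bar>) \<longlonglongrightarrow> \<bar>q\<bar>" using lim by (rule tendsto_rabs)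
    then have "\<forall>\<^sub>F n in sequentially. \<bar>Q (t n)\<bar> > 2 * k"
      using k by (intro order_tendstoD) (auto simp: k_def)
    then show ?thesis
    proof eventually_elim
      case (elim n)
      \<comment> \<open>Comparison with a line of slope \<open>k / K\<close>: on the window,
        \<open>E' \<ge> \<bar>Q\<bar> / K \<ge> k / K\<close>.\<close>
      have "- E (t n + \<delta>) + k / K * (t n + \<delta>) \<le> - E (t n) + k / K * t n"
      proof (rule nonincreasing_if_derivative_nonpos
          [where f = "\<lambda>s. - E s + k / K * s" and f' = "\<lambda>s. - E' s + k / K"])
        fix s assume s: "t n \<le> s" "s \<le> t n + \<delta>"
        have "\<bar>Q s - Q (t n)\<bar> \<le> L * \<bar>s - t n\<bar>"
          using lipschitz_onD[OF lip, of s "t n"] t(1)[of n] s by (auto simp: dist_real_def)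
        also have "\<dots> \<le> L * \<delta>" using s L by (intro mult_left_mono) auto
        finally have "k \<le> \<bar>Q s\<bar>" using elim \<delta>(2) by linarith
        also have "\<dots> \<le> K * E' s" using dom[of s] t(1)[of n] s by linarith
        finally show "- E' s + k / K \<le> 0" using \<open>K > 0\<close> by (simp add: field_simps)
      qed (use t(1)[of n] \<delta> \<open>K > 0\<close> in \<open>auto intro!: derivative_eq_intros der\<close>)
      then show ?case by (simp add: algebra_simps)
    qed
  qed
  have gain: "k / K * \<delta> > 0" using k \<open>K > 0\<close> \<delta> by simp
  \<comment> \<open>From some time \<open>s0\<close> on, the monotone function \<open>E\<close> is
    closer to its supremum than the gain of one window, so a late window would push it above the
    supremum.\<close>
  let ?S = "SUP s\<in>{0..}. E s"
  have "bdd_above (E ` {0..})" using bdd by (auto intro!: bdd_aboveI[of _ C])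
  then obtain s0 where s0: "s0 \<ge> 0" "E s0 > ?S - k / K * \<delta>" and upper: "\<And>s. s \<ge> 0 \<Longrightarrow> E s \<le> ?S"
    using less_cSUP_iff[of "{0..}" E "?S - k / K * \<delta>"] gain by (auto intro: cSUP_upper)
  from t(2) have "\<forall>\<^sub>F n in sequentially. t n \<ge> s0" by (simp add: filterlim_at_top)
  with ev have "\<forall>\<^sub>F n in sequentially. False"
  proof eventually_elim
    case (elim n)
    show ?case using elim upper[of "t n + \<delta>"] mono[of s0 "t n"] s0 t(1)[of n] \<delta> by linarith
  qed
  then show False by simp
qed

section \<open>Essentially bounded functions and their integrals\<close>

lemma Linf_iff:
  "f \<in> Linf M \<longleftrightarrow> f \<in> borel_measurable M \<and> (\<exists>c. AE x in M. \<bar>f x\<bar> \<le> c)"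
proof safe
  assume "f \<in> Linf M"
  then have f: "f \<in> borel_measurable M" and s: "esssup M (\<lambda>x. ereal \<bar>f x\<bar>) < \<infinity>"
    by (auto simp: Linf_def)
  show "f \<in> borel_measurable M" by fact
  have "AE x in M. ereal \<bar>f x\<bar> \<le> esssup M (\<lambda>x. ereal \<bar>f x\<bar>)" by (rule esssup_AE)
  then show "\<exists>c. AE x in M. \<bar>f x\<bar> \<le> c"
    using s by (cases "esssup M (\<lambda>x. ereal \<bar>f x\<bar>)") auto
next
  fix c assume "f \<in> borel_measurable M" "AE x in M. \<bar>f x\<bar> \<le> c"
  then show "f \<in> Linf M"
    using esssup_I[of "\<lambda>x. ereal \<bar>f x\<bar>" M "ereal c"] by (auto simp: Linf_def)
qed

lemma Linf_measurable [measurable_dest]: "f \<in> Linf M \<Longrightarrow> f \<in> borel_measurable M"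
  by (simp add: Linf_def)

lemma Linf_I: "\<lbrakk>f \<in> borel_measurable M; AE x in M. \<bar>f x\<bar> \<le> c\<rbrakk> \<Longrightarrow> f \<in> Linf M"
  by (auto simp: Linf_iff)

lemma AE_le_Linf_norm:
  assumes "f \<in> Linf M" shows "AE x in M. \<bar>f x\<bar> \<le> Linf_norm M f"
proof -
  have "AE x in M. ereal \<bar>f x\<bar> \<le> esssup M (\<lambda>x. ereal \<bar>f x\<bar>)" by (rule esssup_AE)
  then show ?thesis using assms
    by (cases "esssup M (\<lambda>x. ereal \<bar>f x\<bar>)") (auto simp: Linf_def Linf_norm_def)
qed

lemma Linf_norm_le:
  assumes "f \<in> borel_measurable M" "AE x in M. \<bar>f x\<bar> \<le> c" "c \<ge> 0"
  shows "Linf_norm M f \<le> c"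
proof -
  have "esssup M (\<lambda>x. ereal \<bar>f x\<bar>) \<le> ereal c" using assms by (intro esssup_I) auto
  then show ?thesis using \<open>c \<ge> 0\<close>
    by (cases "esssup M (\<lambda>x. ereal \<bar>f x\<bar>)") (auto simp: Linf_norm_def)
qed

text \<open>A negative bound on \<open>\<bar>f x\<bar>\<close> can hold almost everywhere only on a
  null space; there the essential supremum is \<open>-\<infinity>\<close>, which
  \<open>real_of_ereal\<close> maps to 0.\<close>

lemma Linf_norm_nonneg:
  assumes "f \<in> Linf M" shows "Linf_norm M f \<ge> 0"
proof (rule ccontr)
  assume neg: "\<not> Linf_norm M f \<ge> 0"
  with AE_le_Linf_norm[OF assms] have "AE x in M. ereal \<bar>f x\<bar> \<le> -\<infinity>"
    by (auto elim!: eventually_mono)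
  then have "esssup M (\<lambda>x. ereal \<bar>f x\<bar>) \<le> -\<infinity>"
    using assms by (intro esssup_I) (auto simp: Linf_def)
  with neg show False by (simp add: Linf_norm_def)
qed

lemma Linf_diff:
  assumes "f \<in> Linf M" "g \<in> Linf M" shows "(\<lambda>x. f x - g x) \<in> Linf M"
proof -
  obtain c d where "AE x in M. \<bar>f x\<bar> \<le> c" "AE x in M. \<bar>g x\<bar> \<le> d"
    using assms by (auto simp: Linf_iff)
  then have "AE x in M. \<bar>f x - g x\<bar> \<le> c + d" by eventually_elim linarith
  then show ?thesis using assms by (intro Linf_I) (auto simp: Linf_def)
qed

lemma Linf_cmult:
  assumes "f \<in> Linf M" shows "(\<lambda>x. r * f x) \<in> Linf M"
proof -
  obtain c where "AE x in M. \<bar>f x\<bar> \<le> c" using assms by (auto simp: Linf_iff)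
  then have "AE x in M. \<bar>r * f x\<bar> \<le> \<bar>r\<bar> * c"
    by eventually_elim (simp add: abs_mult mult_left_mono)
  then show ?thesis using assms by (intro Linf_I) (auto simp: Linf_def)
qed

lemma Linf_mult:
  assumes "f \<in> Linf M" "g \<in> Linf M" shows "(\<lambda>x. f x * g x) \<in> Linf M"
proof -
  obtain c d where "AE x in M. \<bar>f x\<bar> \<le> c" "AE x in M. \<bar>g x\<bar> \<le> d"
    using assms by (auto simp: Linf_iff)
  then have "AE x in M. \<bar>f x * g x\<bar> \<le> \<bar>c\<bar> * \<bar>d\<bar>"
    by eventually_elim (auto simp: abs_mult intro!: mult_mono)
  then show ?thesis using assms by (intro Linf_I) (auto simp: Linf_def)
qed

lemma Linf_compose:
  assumes "f \<in> Linf M" "continuous_on UNIV h" shows "(\<lambda>x. h (f x)) \<in> Linf M"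
proof -
  obtain c where c: "AE x in M. \<bar>f x\<bar> \<le> c" using assms by (auto simp: Linf_iff)
  obtain C where C: "\<forall>y\<in>{-c..c}. \<bar>h y\<bar> \<le> C"
    using continuous_bounded_on_Icc[OF assms(2)] by blast
  from c have "AE x in M. \<bar>h (f x)\<bar> \<le> C" by eventually_elim (use C in \<open>auto simp: abs_le_iff\<close>)
  moreover have "(\<lambda>x. h (f x)) \<in> borel_measurable M"
    using assms by (intro borel_measurable_continuous_on[OF assms(2)]) (auto simp: Linf_def)
  ultimately show ?thesis by (intro Linf_I)
qed

lemma (in finite_measure) Linf_integrable: "f \<in> Linf M \<Longrightarrow> integrable M f"
  by (auto simp: Linf_iff intro!: integrable_const_bound)

lemma (in finite_measure) abs_integral_le:
  fixes f :: "'a \<Rightarrow> real"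
  assumes "AE x in M. \<bar>f x\<bar> \<le> c" "c \<ge> 0"
  shows "\<bar>LINT x|M. f x\<bar> \<le> c * measure M (space M)"
proof -
  have "\<bar>LINT x|M. f x\<bar> \<le> (LINT x|M. \<bar>f x\<bar>)" by simp
  also have "\<dots> \<le> (LINT x|M. c)"
    using assms by (intro integral_mono_AE') auto
  finally show ?thesis by (simp add: mult.commute)
qed

text \<open>Cauchy-Schwarz against the constant 1, read off from the nonnegative integral of
  \<open>(m * f x - I)^2\<close>. The final cancellation of a factor \<open>m\<close> is why total
  mass 0 is treated separately.\<close>

lemma (in finite_measure) square_integral_le:
  assumes "f \<in> Linf M"
  shows "(LINT x|M. f x)\<^sup>2 \<le> measure M (space M) * (LINT x|M. (f x)\<^sup>2)"
proof (cases "measure M (space M) = 0")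
  case True
  then have "emeasure M (space M) = 0" by (simp add: emeasure_eq_measure)
  then have "AE x in M. f x = 0" by (auto simp: AE_iff_null null_sets_def intro!: emeasure_0_AE)
  then have "(LINT x|M. f x) = (LINT x|M. 0)" by (intro integral_cong_AE) (use assms in auto)
  with True show ?thesis by simp
next
  case False
  define m where "m = measure M (space M)"
  define I where "I = (LINT x|M. f x)"
  have m: "m > 0" using False by (simp add: m_def zero_less_measure_iff)
  note [simp] = Linf_integrable[OF assms] Linf_integrable[OF Linf_mult[OF assms assms]]
  have "0 \<le> (LINT x|M. (m * f x - I)\<^sup>2)" by simp
  also have "\<dots> = (LINT x|M. m\<^sup>2 * (f x * f x) - 2 * m * I * f x + I\<^sup>2)"
    by (intro Bochner_Integration.integral_cong) (auto simp: power2_eq_square algebra_simps)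
  also have "\<dots> = m\<^sup>2 * (LINT x|M. f x * f x) - 2 * m * I * I + I\<^sup>2 * m"
    by (simp add: I_def m_def mult.commute)
  also have "\<dots> = m * (m * (LINT x|M. (f x)\<^sup>2) - I\<^sup>2)"
    by (simp add: power2_eq_square algebra_simps)
  finally show ?thesis using m by (simp add: zero_le_mult_iff m_def I_def)
qed

section \<open>Differentiable curves in \<open>L\<^sup>\<infinity>\<close>\<close>

text \<open>Separates a norm-differentiable curve from the equation it solves: the chain rule and
  the barrier principle are proved at this level for an arbitrary velocity \<open>w\<close>.\<close>

locale Linf_curve = finite_measure M for M :: "'a measure" +
  fixes u w :: "real \<Rightarrow> 'a \<Rightarrow> real"
  assumes u_Linf: "t \<ge> 0 \<Longrightarrow> u t \<in> Linf M"
    and u_deriv: "t \<ge> 0 \<Longrightarrow> has_Linf_derivative M u (w t) t {0..}"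
begin

lemma w_Linf: "t \<ge> 0 \<Longrightarrow> w t \<in> Linf M"
  using u_deriv by (auto simp: has_Linf_derivative_def)

lemma integrable_compose:
  fixes h :: "real \<Rightarrow> real"
  assumes "t \<ge> 0" "continuous_on UNIV h"
  shows "integrable M (\<lambda>x. h (u t x))"
  by (rule Linf_integrable[OF Linf_compose[OF u_Linf]]) (use assms in auto)

lemma integrable_compose_mult_w:
  fixes h :: "real \<Rightarrow> real"
  assumes "t \<ge> 0" "continuous_on UNIV h"
  shows "integrable M (\<lambda>x. h (u t x) * w t x)"
  by (rule Linf_integrable[OF Linf_mult[OF Linf_compose[OF u_Linf] w_Linf]]) (use assms in auto)

text \<open>Smallness of the \<open>Linf_norm\<close> is a pointwise bound almost everywhere, and
  multiplying by \<open>\<bar>s - t\<bar>\<close> clears the difference quotient. In this form the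
  derivative enters the estimates below; the exceptional null set may depend on
  \<open>s\<close>.\<close>

lemma eventually_increment:
  assumes "t \<ge> 0" "e > 0"
  shows "\<forall>\<^sub>F s in at t within {0..}. s \<ge> 0 \<and> s \<noteq> t \<and>
    (AE x in M. \<bar>u s x - u t x - (s - t) * w t x\<bar> \<le> e * \<bar>s - t\<bar>)"
proof -
  let ?q = "\<lambda>s x. (u s x - u t x) / (s - t) - w t x"
  have "((\<lambda>s. Linf_norm M (?q s)) \<longlongrightarrow> 0) (at t within {0..})"
    using u_deriv[OF assms(1)] by (simp add: has_Linf_derivative_def)
  then have "\<forall>\<^sub>F s in at t within {0..}. Linf_norm M (?q s) < e"
    using assms(2) by (rule order_tendstoD)
  moreover have "\<forall>\<^sub>F s in at t within {0..}. s \<ge> 0 \<and> s \<noteq> t"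
    by (auto simp: eventually_at_filter)
  ultimately show ?thesis
  proof eventually_elim
    case (elim s)
    have "(\<lambda>x. (1 / (s - t)) * (u s x - u t x) - w t x) \<in> Linf M"
      using elim assms by (intro Linf_diff Linf_cmult u_Linf w_Linf) auto
    then have "AE x in M. \<bar>?q s x\<bar> \<le> Linf_norm M (?q s)"
      by (intro AE_le_Linf_norm) (simp add: field_simps)
    then have "AE x in M. \<bar>u s x - u t x - (s - t) * w t x\<bar> \<le> e * \<bar>s - t\<bar>"
    proof eventually_elim
      case (elim x)
      have "\<bar>u s x - u t x - (s - t) * w t x\<bar> = \<bar>s - t\<bar> * \<bar>?q s x\<bar>"
        using \<open>0 \<le> s \<and> s \<noteq> t\<close> by (simp add: abs_mult[symmetric] field_simps)
      also have "\<dots> \<le> \<bar>s - t\<bar> * e"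
        using elim \<open>Linf_norm M (?q s) < e\<close> by (intro mult_left_mono) auto
      finally show ?case by (simp add: mult.commute)
    qed
    with elim show ?case by blast
  qed
qed

text \<open>Chain rule under the integral. The remainder \<open>?r\<close> splits into the Taylor
  error of \<open>h\<close> and \<open>h' (u t x)\<close> times the error of \<open>u\<close>. Both
  are at most a small constant times \<open>\<bar>s - t\<bar>\<close> almost everywhere, and
  integration over a finite measure preserves this.\<close>

lemma integral_has_derivative:
  assumes h: "\<And>y. (h has_real_derivative h' y) (at y)" "continuous_on UNIV h'" and "t \<ge> 0"
  shows "((\<lambda>s. LINT x|M. h (u s x)) has_real_derivative (LINT x|M. h' (u t x) * w t x))
    (at t within {0..})"
  unfolding has_field_derivative_iff
proof (rule tendstoI)
  fix e :: real assume "e > 0"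
  have h_cont: "continuous_on UNIV h"
    using h(1) by (meson DERIV_isCont continuous_at_imp_continuous_on)
  define m where "m = measure M (space M) + 1"
  have m: "m > 0" by (simp add: m_def add_nonneg_pos)
  obtain R where R: "AE x in M. \<bar>u t x\<bar> \<le> R"
    using u_Linf[OF \<open>t \<ge> 0\<close>] by (auto simp: Linf_iff)
  obtain W0 where W0: "AE x in M. \<bar>w t x\<bar> \<le> W0"
    using w_Linf[OF \<open>t \<ge> 0\<close>] by (auto simp: Linf_iff)
  define W where "W = \<bar>W0\<bar>"
  have W: "AE x in M. \<bar>w t x\<bar> \<le> W" using W0 by eventually_elim (auto simp: W_def)
  have "W \<ge> 0" by (simp add: W_def)
  obtain C where C: "C > 0" "\<forall>y\<in>{-R..R}. \<bar>h' y\<bar> \<le> C"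
    using continuous_bounded_on_Icc[OF h(2)] by blast
  \<comment> \<open>\<open>e1\<close> and \<open>e2\<close> are chosen so that each of the two
    errors costs at most \<open>e / (4 * m)\<close>. The cap \<open>e2 \<le> 1\<close> yields the a
    priori bound \<open>\<bar>s - t\<bar> * (W + 1)\<close> on the increment of
    \<open>u\<close>.\<close>
  define e1 where "e1 = e / (4 * m * (W + 1))"
  have e1: "e1 > 0" using \<open>e > 0\<close> m \<open>W \<ge> 0\<close> by (simp add: e1_def)
  define e2 where "e2 = min 1 (e / (4 * m * C))"
  have e2: "e2 > 0" "e2 \<le> 1" using \<open>e > 0\<close> m C by (auto simp: e2_def)
  have small: "e1 * (W + 1) + C * e2 \<le> e / (2 * m)"
  proof -
    have "e1 * (W + 1) = e / (4 * m)" using \<open>W \<ge> 0\<close> m by (simp add: e1_def)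
    moreover have "C * e2 \<le> C * (e / (4 * m * C))" using C by (intro mult_left_mono) (auto simp: e2_def)
    moreover have "C * (e / (4 * m * C)) = e / (4 * m)" using C by simp
    ultimately show ?thesis by (simp add: field_simps)
  qed
  obtain d where d: "d > 0" "\<And>x y. \<lbrakk>\<bar>x\<bar> \<le> R; \<bar>y - x\<bar> < d\<rbrakk> \<Longrightarrow>
      \<bar>h y - h x - h' x * (y - x)\<bar> \<le> e1 * \<bar>y - x\<bar>"
    using C1_uniform_expansion[OF h e1, of R] by blast
  have "((\<lambda>s. \<bar>s - t\<bar> * (W + 1)) \<longlongrightarrow> \<bar>t - t\<bar> * (W + 1)) (at t within {0..})"
    by (intro tendsto_intros)
  then have "\<forall>\<^sub>F s in at t within {0..}. \<bar>s - t\<bar> * (W + 1) < d"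
    using d(1) by (intro order_tendstoD) auto
  then show "\<forall>\<^sub>F s in at t within {0..}. dist (((LINT x|M. h (u s x)) - (LINT x|M. h (u t x))) / (s - t))
      (LINT x|M. h' (u t x) * w t x) < e"
    using eventually_increment[OF \<open>t \<ge> 0\<close> e2(1)]
  proof eventually_elim
    case (elim s)
    then have s: "s \<ge> 0" "s \<noteq> t" and sd: "\<bar>s - t\<bar> * (W + 1) < d"
      and ae: "AE x in M. \<bar>u s x - u t x - (s - t) * w t x\<bar> \<le> e2 * \<bar>s - t\<bar>" by auto
    let ?r = "\<lambda>x. h (u s x) - h (u t x) - (s - t) * (h' (u t x) * w t x)"
    have "AE x in M. \<bar>?r x\<bar> \<le> e / (2 * m) * \<bar>s - t\<bar>"
      using R W ae
    proof eventually_elim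
      case (elim x)
      define z where "z = u s x - u t x"
      have "\<bar>(s - t) * w t x\<bar> \<le> \<bar>s - t\<bar> * W"
        using elim by (simp add: abs_mult mult_left_mono)
      moreover have "e2 * \<bar>s - t\<bar> \<le> 1 * \<bar>s - t\<bar>" using e2 by (intro mult_right_mono) auto
      ultimately have z: "\<bar>z\<bar> \<le> \<bar>s - t\<bar> * (W + 1)"
        using elim unfolding z_def distrib_left by linarith
      have 1: "\<bar>h (u s x) - h (u t x) - h' (u t x) * z\<bar> \<le> e1 * \<bar>z\<bar>"
        unfolding z_def using elim z sd by (intro d(2)) (auto simp: z_def)
      have 2: "e1 * \<bar>z\<bar> \<le> e1 * (\<bar>s - t\<bar> * (W + 1))" using z e1 by (intro mult_left_mono) auto
      have "\<bar>h' (u t x) * (z - (s - t) * w t x)\<bar> \<le> C * (e2 * \<bar>s - t\<bar>)"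
        unfolding abs_mult using elim C by (intro mult_mono) (auto simp: z_def abs_le_iff)
      moreover have "?r x = h (u s x) - h (u t x) - h' (u t x) * z
          + h' (u t x) * (z - (s - t) * w t x)"
        by (simp add: algebra_simps)
      ultimately have "\<bar>?r x\<bar> \<le> e1 * (\<bar>s - t\<bar> * (W + 1)) + C * (e2 * \<bar>s - t\<bar>)"
        using 1 2 by linarith
      also have "\<dots> = (e1 * (W + 1) + C * e2) * \<bar>s - t\<bar>" by (simp add: algebra_simps)
      also have "\<dots> \<le> e / (2 * m) * \<bar>s - t\<bar>" using small by (rule mult_right_mono) simp
      finally show ?case .
    qed
    then have "\<bar>LINT x|M. ?r x\<bar> \<le> e / (2 * m) * \<bar>s - t\<bar> * measure M (space M)"
      using \<open>e > 0\<close> m by (intro abs_integral_le) auto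
    also have "\<dots> \<le> e / (2 * m) * \<bar>s - t\<bar> * m"
      using \<open>e > 0\<close> m by (intro mult_left_mono) (auto simp: m_def)
    also have "\<dots> < e * \<bar>s - t\<bar>" using \<open>e > 0\<close> m s by simp
    finally have r: "\<bar>LINT x|M. ?r x\<bar> < e * \<bar>s - t\<bar>" .
    have "(LINT x|M. ?r x) = (LINT x|M. h (u s x)) - (LINT x|M. h (u t x))
        - (s - t) * (LINT x|M. h' (u t x) * w t x)"
      using integrable_compose[OF s(1) h_cont] integrable_compose[OF \<open>t \<ge> 0\<close> h_cont]
        integrable_compose_mult_w[OF \<open>t \<ge> 0\<close> h(2)] by simp
    also have "\<dots> = (s - t) * (((LINT x|M. h (u s x)) - (LINT x|M. h (u t x))) / (s - t)
        - (LINT x|M. h' (u t x) * w t x))"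
      using s by (simp add: field_simps)
    finally have "\<bar>s - t\<bar> * \<bar>((LINT x|M. h (u s x)) - (LINT x|M. h (u t x))) / (s - t)
        - (LINT x|M. h' (u t x) * w t x)\<bar> < \<bar>s - t\<bar> * e"
      using r by (simp add: abs_mult mult.commute)
    then show ?case using s by (simp add: dist_real_def)
  qed
qed

lemma continuous_on_integral:
  assumes "\<And>y. (h has_real_derivative h' y) (at y)" "continuous_on UNIV h'"
  shows "continuous_on {0..} (\<lambda>t. LINT x|M. h (u t x))"
  by (rule DERIV_continuous_on, rule integral_has_derivative[OF assms]) auto

text \<open>By the triangle inequality, used in both directions, the norm of \<open>u t\<close> is
  continuous in \<open>t\<close>, hence bounded on a compact time interval.\<close>

lemma uniformly_bounded_on_Icc: "\<exists>R>0. \<forall>t\<in>{0..T}. AE x in M. \<bar>u t x\<bar> \<le> R"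
proof -
  have "continuous_on {0..} (\<lambda>t. Linf_norm M (u t))"
    unfolding continuous_on_def
  proof (intro ballI tendstoI)
    fix t e :: real assume "t \<in> {0..}" "e > 0"
    then have t: "t \<ge> 0" by simp
    define W where "W = \<bar>Linf_norm M (w t)\<bar>"
    have W: "AE x in M. \<bar>w t x\<bar> \<le> W"
      using AE_le_Linf_norm[OF w_Linf[OF t]] by eventually_elim (auto simp: W_def)
    have "((\<lambda>s. \<bar>s - t\<bar> * (W + 1)) \<longlongrightarrow> \<bar>t - t\<bar> * (W + 1)) (at t within {0..})"
      by (intro tendsto_intros)
    then have "\<forall>\<^sub>F s in at t within {0..}. \<bar>s - t\<bar> * (W + 1) < e"
      using \<open>e > 0\<close> by (intro order_tendstoD) auto
    then show "\<forall>\<^sub>F s in at t within {0..}. dist (Linf_norm M (u s)) (Linf_norm M (u t)) < e"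
      using eventually_increment[OF t zero_less_one]
    proof eventually_elim
      case (elim s)
      have diff: "AE x in M. \<bar>u s x - u t x\<bar> \<le> \<bar>s - t\<bar> * (W + 1)"
        using W elim(2)[THEN conjunct2, THEN conjunct2]
      proof eventually_elim
        case (elim x)
        have "\<bar>(s - t) * w t x\<bar> \<le> \<bar>s - t\<bar> * W"
          using elim by (simp add: abs_mult mult_left_mono)
        then show ?case using elim by (simp add: distrib_left)
      qed
      have le: "Linf_norm M (u a) \<le> \<bar>Linf_norm M (u b)\<bar> + \<bar>s - t\<bar> * (W + 1)"
        if "a \<ge> 0" "b \<ge> 0" "AE x in M. \<bar>u a x - u b x\<bar> \<le> \<bar>s - t\<bar> * (W + 1)" for a b
      proof (rule Linf_norm_le)
        show "AE x in M. \<bar>u a x\<bar> \<le> \<bar>Linf_norm M (u b)\<bar> + \<bar>s - t\<bar> * (W + 1)"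
          using that(3) AE_le_Linf_norm[OF u_Linf[OF \<open>b \<ge> 0\<close>]] by eventually_elim linarith
        show "0 \<le> \<bar>Linf_norm M (u b)\<bar> + \<bar>s - t\<bar> * (W + 1)"
          by (simp add: W_def)
      qed (use u_Linf[OF \<open>a \<ge> 0\<close>] in \<open>simp add: Linf_measurable\<close>)
      have "AE x in M. \<bar>u t x - u s x\<bar> \<le> \<bar>s - t\<bar> * (W + 1)"
        using diff by eventually_elim linarith
      then show ?case
        using le[OF _ t diff] le[OF t, of s] elim t Linf_norm_nonneg[OF u_Linf[OF t]]
          Linf_norm_nonneg[OF u_Linf, of s]
        by (auto simp: dist_real_def abs_less_iff)
    qed
  qed
  then have "continuous_on {0..T} (\<lambda>t. Linf_norm M (u t))" by (rule continuous_on_subset) auto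
  then have "compact ((\<lambda>t. Linf_norm M (u t)) ` {0..T})"
    by (intro compact_continuous_image) auto
  then obtain R where R: "R > 0" "\<And>t. t \<in> {0..T} \<Longrightarrow> \<bar>Linf_norm M (u t)\<bar> \<le> R"
    using compact_imp_bounded bounded_pos by (metis (no_types, lifting) imageI real_norm_def)
  have "AE x in M. \<bar>u t x\<bar> \<le> R" if "t \<in> {0..T}" for t
    using AE_le_Linf_norm[OF u_Linf, of t] that R(2)[OF that] by fastforce
  with R(1) show ?thesis by blast
qed

text \<open>The sign \<open>\<sigma>\<close> selects an upper (\<open>1\<close>) or lower
  (\<open>-1\<close>) barrier. The integral of the squared excess \<open>m\<close> starts at 0, and
  its derivative is twice the left side of \<open>growth\<close>, so Gronwall's inequality keeps it
  at 0.\<close>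

lemma barrier:
  fixes \<sigma> c :: real
  defines "m \<equiv> \<lambda>t x. max 0 (\<sigma> * (u t x - c))"
  assumes \<sigma>: "\<bar>\<sigma>\<bar> = 1" and init: "AE x in M. \<sigma> * (u 0 x - c) \<le> 0"
    and growth: "\<exists>K. \<forall>t\<in>{0..T}. (LINT x|M. \<sigma> * m t x * w t x) \<le> K * (LINT x|M. (m t x)\<^sup>2)"
    and "T \<ge> 0"
  shows "AE x in M. \<sigma> * (u T x - c) \<le> 0"
proof -
  let ?h = "\<lambda>y. (max 0 (\<sigma> * (y - c)))\<^sup>2" and ?h' = "\<lambda>y. 2 * (\<sigma> * max 0 (\<sigma> * (y - c)))"
  have h: "(?h has_real_derivative ?h' y) (at y)" for y
  proof -
    have "((\<lambda>y. \<sigma> * (y - c)) has_real_derivative \<sigma>) (at y)"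
      by (auto intro!: derivative_eq_intros)
    from DERIV_chain2[OF pos_part_square_has_derivative this] show ?thesis
      by (simp add: mult_ac)
  qed
  have h': "continuous_on UNIV ?h'" by (intro continuous_intros)
  have hc: "continuous_on UNIV ?h" by (intro continuous_intros)
  obtain K where K: "\<forall>t\<in>{0..T}. (LINT x|M. \<sigma> * m t x * w t x) \<le> K * (LINT x|M. (m t x)\<^sup>2)"
    using growth by blast
  have "(LINT x|M. (m T x)\<^sup>2) = 0"
  proof (rule gronwall_zero[where E = "\<lambda>t. LINT x|M. (m t x)\<^sup>2" and K = "2 * K"
        and E' = "\<lambda>t. LINT x|M. ?h' (u t x) * w t x"])
    show "((\<lambda>t. LINT x|M. (m t x)\<^sup>2) has_real_derivative (LINT x|M. ?h' (u t x) * w t x))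
        (at t within {0..})" if "t \<ge> 0" for t
      unfolding m_def using h h' that by (rule integral_has_derivative)
    have "(LINT x|M. (m 0 x)\<^sup>2) = (LINT x|M. 0)"
      using init u_Linf[of 0] unfolding m_def by (intro integral_cong_AE) (auto simp: Linf_measurable)
    then show "(LINT x|M. (m 0 x)\<^sup>2) = 0" by simp
    show "(LINT x|M. ?h' (u t x) * w t x) \<le> 2 * K * (LINT x|M. (m t x)\<^sup>2)" if "0 \<le> t" "t \<le> T" for t
    proof -
      have "(LINT x|M. ?h' (u t x) * w t x) = 2 * (LINT x|M. \<sigma> * m t x * w t x)"
        unfolding m_def by (subst integral_mult_right_zero[symmetric]) (simp add: mult.assoc)
      with K that show ?thesis by auto
    qed
  qed (use \<open>T \<ge> 0\<close> in auto)
  moreover have "integrable M (\<lambda>x. (m T x)\<^sup>2)"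
    unfolding m_def by (rule integrable_compose[OF \<open>T \<ge> 0\<close> hc])
  ultimately have "AE x in M. (m T x)\<^sup>2 = 0"
    by (subst (asm) integral_nonneg_eq_0_iff_AE) auto
  then show ?thesis by eventually_elim (auto simp: m_def)
qed

end

section \<open>Conservation of mass and barriers\<close>

text \<open>The problem posed on an abstract finite measure space; Lebesgue measure enters only when
  limits are described through level sets. The velocity in \<open>flow_deriv\<close> is
  \<open>nonlocal_F\<close> written out for \<open>M\<close>.\<close>

locale nonlocal_flow = finite_measure M for M :: "'a measure" +
  fixes u :: "real \<Rightarrow> 'a \<Rightarrow> real" and g g' p p' :: "real \<Rightarrow> real"
  assumes flow_Linf: "t \<ge> 0 \<Longrightarrow> u t \<in> Linf M"
    and g_deriv: "(g has_real_derivative g' y) (at y)" and g'_cont: "continuous_on UNIV g'"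
    and p_deriv: "(p has_real_derivative p' y) (at y)" and p'_cont: "continuous_on UNIV p'"
    and p_mono: "strict_mono p"
    and nondegenerate: "t \<ge> 0 \<Longrightarrow> (LINT x|M. g (u t x)) \<noteq> 0"
    and flow_deriv: "t \<ge> 0 \<Longrightarrow> has_Linf_derivative M u
      (\<lambda>x. g (u t x) * p (u t x) - g (u t x) *
        ((LINT y|M. g (u t y) * p (u t y)) / (LINT y|M. g (u t y)))) t {0..}"
begin

definition A :: "real \<Rightarrow> real" where "A t = (LINT x|M. g (u t x))"
definition B :: "real \<Rightarrow> real" where "B t = (LINT x|M. g (u t x) * p (u t x))"
text \<open>The mean of \<open>p (u t x)\<close> for the weight \<open>g (u t x)\<close>, a true
  average where \<open>g (u t x)\<close> keeps one sign.\<close>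

definition lam :: "real \<Rightarrow> real" where "lam t = B t / A t"
definition w :: "real \<Rightarrow> 'a \<Rightarrow> real" where "w t x = g (u t x) * (p (u t x) - lam t)"

sublocale Linf_curve M u w
proof unfold_locales
  fix t :: real assume "t \<ge> 0"
  then show "u t \<in> Linf M" by (rule flow_Linf)
  show "has_Linf_derivative M u (w t) t {0..}"
    using flow_deriv[OF \<open>t \<ge> 0\<close>]
    by (simp add: w_def[abs_def] lam_def A_def B_def right_diff_distrib)
qed

lemma g_cont: "continuous_on UNIV g" and p_cont: "continuous_on UNIV p"
  using g_deriv p_deriv by (meson DERIV_isCont continuous_at_imp_continuous_on)+

lemma gp_deriv: "((\<lambda>y. g y * p y) has_real_derivative g' y * p y + g y * p' y) (at y)"
  by (auto intro!: derivative_eq_intros g_deriv p_deriv)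

lemma gp'_cont: "continuous_on UNIV (\<lambda>y. g' y * p y + g y * p' y)"
  by (intro continuous_intros g_cont p_cont g'_cont p'_cont)

lemma gp_cont: "continuous_on UNIV (\<lambda>y. g y * p y)"
  by (intro continuous_intros g_cont p_cont)

lemma A_nonzero: "t \<ge> 0 \<Longrightarrow> A t \<noteq> 0"
  using nondegenerate by (simp add: A_def)

lemma A_continuous: "continuous_on {0..} A"
  unfolding A_def[abs_def] by (rule continuous_on_integral[OF g_deriv g'_cont])

lemma B_continuous: "continuous_on {0..} B"
  unfolding B_def[abs_def] by (rule continuous_on_integral[OF gp_deriv gp'_cont])

text \<open>Continuity on a compact interval. The bound may depend on \<open>T\<close>, which is
  enough for Gronwall arguments up to time \<open>T\<close>.\<close>

lemma lam_bounded: "\<exists>K>0. \<forall>t\<in>{0..T}. \<bar>lam t\<bar> \<le> K"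
proof -
  have "continuous_on {0..} lam"
    unfolding lam_def[abs_def]
    by (intro continuous_intros A_continuous B_continuous) (use A_nonzero in auto)
  then have "compact (lam ` {0..T})"
    by (intro compact_continuous_image) (auto intro: continuous_on_subset)
  then obtain K where "K > 0" "\<forall>y\<in>lam ` {0..T}. norm y \<le> K"
    using compact_imp_bounded bounded_pos by metis
  then show ?thesis by auto
qed

lemma A_bounded_below: "\<exists>c>0. \<forall>t\<in>{0..T}. c \<le> \<bar>A t\<bar>"
proof (cases "T \<ge> 0")
  case True
  have "continuous_on {0..T} (\<lambda>t. \<bar>A t\<bar>)"
    by (intro continuous_intros continuous_on_subset[OF A_continuous]) auto
  with True obtain t where "t \<in> {0..T}" "\<forall>s\<in>{0..T}. \<bar>A t\<bar> \<le> \<bar>A s\<bar>"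
    using continuous_attains_inf[of "{0..T}" "\<lambda>t. \<bar>A t\<bar>"] by auto
  with A_nonzero[of t] show ?thesis by (intro exI[of _ "\<bar>A t\<bar>"]) auto
qed (auto intro: exI[of _ 1])

text \<open>\<open>lam t\<close> is exactly the constant that gives the velocity mean zero; this is
  conservation of mass in differential form.\<close>

lemma integral_w: "t \<ge> 0 \<Longrightarrow> (LINT x|M. w t x) = 0"
proof -
  assume t: "t \<ge> 0"
  have "(LINT x|M. w t x) = (LINT x|M. g (u t x) * p (u t x) - lam t * g (u t x))"
    by (simp add: w_def right_diff_distrib mult.commute)
  also have "\<dots> = B t - lam t * A t"
    using integrable_compose[OF t gp_cont] integrable_compose[OF t g_cont]
    by (simp add: A_def B_def)
  finally show ?thesis using A_nonzero[OF t] by (simp add: lam_def)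
qed

lemma mass_conserved:
  assumes "t \<ge> 0" shows "(LINT x|M. u t x) = (LINT x|M. u 0 x)"
proof -
  have der: "((\<lambda>s. LINT x|M. u s x) has_real_derivative 0) (at s within {0..})" if "s \<ge> 0" for s
    using integral_has_derivative[of "\<lambda>y. y" "\<lambda>_. 1" s] integral_w[OF that] that
    by (auto intro: derivative_intros)
  show ?thesis
  proof (rule antisym)
    show "(LINT x|M. u t x) \<le> (LINT x|M. u 0 x)"
      using der assms
      by (intro nonincreasing_if_derivative_nonpos[where f = "\<lambda>s. LINT x|M. u s x" and f' = "\<lambda>_. 0"])
        auto
    have "- (LINT x|M. u t x) \<le> - (LINT x|M. u 0 x)"
      using assms
      by (intro nonincreasing_if_derivative_nonpos
          [where f = "\<lambda>s. - (LINT x|M. u s x)" and f' = "\<lambda>_. 0"])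
        (auto intro!: derivative_eq_intros der)
    then show "(LINT x|M. u 0 x) \<le> (LINT x|M. u t x)" by simp
  qed
qed

text \<open>Since \<open>g\<close> vanishes at \<open>c\<close> and is Lipschitz on the range of
  \<open>u\<close> up to time \<open>T\<close>, the speed is at most a constant times the distance
  to \<open>c\<close>. This linear bound holds on either side of \<open>c\<close> and whatever the
  sign of \<open>p (u t x) - lam t\<close>.\<close>

lemma zero_barrier:
  assumes \<sigma>: "\<bar>\<sigma>\<bar> = 1" and "g c = 0" and init: "AE x in M. \<sigma> * (u 0 x - c) \<le> 0" and "T \<ge> 0"
  shows "AE x in M. \<sigma> * (u T x - c) \<le> 0"
proof (rule barrier[OF \<sigma> init _ \<open>T \<ge> 0\<close>])
  define m where "m = (\<lambda>t x. max 0 (\<sigma> * (u t x - c)))"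
  obtain R0 where R0: "R0 > 0" "\<forall>t\<in>{0..T}. AE x in M. \<bar>u t x\<bar> \<le> R0"
    using uniformly_bounded_on_Icc by blast
  \<comment> \<open>The interval must contain \<open>c\<close> as well, since the Lipschitz bound is
    applied to the pair \<open>u t x\<close>, \<open>c\<close>.\<close>
  define R where "R = max R0 \<bar>c\<bar>"
  obtain L where L: "L > 0" "\<forall>x\<in>{-R..R}. \<forall>y\<in>{-R..R}. \<bar>g x - g y\<bar> \<le> L * \<bar>x - y\<bar>"
    using C1_lipschitz_on_Icc[OF g_deriv g'_cont] by blast
  obtain P where P: "P > 0" "\<forall>y\<in>{-R..R}. \<bar>p y\<bar> \<le> P"
    using continuous_bounded_on_Icc[OF p_cont] by blast
  obtain K where K: "K > 0" "\<forall>t\<in>{0..T}. \<bar>lam t\<bar> \<le> K" using lam_bounded by blast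
  have "(LINT x|M. \<sigma> * m t x * w t x) \<le> L * (P + K) * (LINT x|M. (m t x)\<^sup>2)"
    if t: "t \<in> {0..T}" for t
  proof -
    have "(LINT x|M. \<sigma> * m t x * w t x) \<le> (LINT x|M. L * (P + K) * (m t x)\<^sup>2)"
    proof (rule integral_mono_AE)
      show "integrable M (\<lambda>x. \<sigma> * m t x * w t x)"
        unfolding m_def using t
        by (intro integrable_compose_mult_w[where h = "\<lambda>y. \<sigma> * max 0 (\<sigma> * (y - c))"])
          (auto intro!: continuous_intros)
      show "integrable M (\<lambda>x. L * (P + K) * (m t x)\<^sup>2)"
        unfolding m_def using t
        by (intro integrable_compose[where h = "\<lambda>y. L * (P + K) * (max 0 (\<sigma> * (y - c)))\<^sup>2"])
          (auto intro!: continuous_intros)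
      show "AE x in M. \<sigma> * m t x * w t x \<le> L * (P + K) * (m t x)\<^sup>2"
        using R0(2)[rule_format, OF t]
      proof eventually_elim
        case (elim x)
        then have ux: "u t x \<in> {-R..R}" "c \<in> {-R..R}" by (auto simp: R_def)
        show ?case
        proof (cases "\<sigma> * (u t x - c) \<le> 0")
          case False
          then have m: "m t x = \<bar>u t x - c\<bar>" using \<sigma> by (auto simp: m_def abs_mult[symmetric] max_def abs_if split: if_splits)
          have "\<bar>g (u t x)\<bar> \<le> L * \<bar>u t x - c\<bar>"
            using L(2)[rule_format, OF ux] \<open>g c = 0\<close> by simp
          moreover have "\<bar>p (u t x) - lam t\<bar> \<le> P + K"
            using P(2)[rule_format, OF ux(1)] K(2)[rule_format, OF t] by linarith
          ultimately have "\<bar>w t x\<bar> \<le> L * \<bar>u t x - c\<bar> * (P + K)"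
            unfolding w_def abs_mult using L(1) by (intro mult_mono) auto
          then have "m t x * \<bar>w t x\<bar> \<le> m t x * (L * \<bar>u t x - c\<bar> * (P + K))"
            unfolding m by (rule mult_left_mono) simp
          moreover have "\<sigma> * m t x * w t x \<le> m t x * \<bar>w t x\<bar>"
            using abs_ge_self[of "\<sigma> * m t x * w t x"] \<sigma> by (simp add: abs_mult m)
          ultimately show ?thesis unfolding m by (simp add: power2_eq_square mult_ac)
        qed (use L P K in \<open>simp add: m_def\<close>)
      qed
    qed
    then show ?thesis by simp
  qed
  then show "\<exists>K. \<forall>t\<in>{0..T}. (LINT x|M. \<sigma> * max 0 (\<sigma> * (u t x - c)) * w t x)
      \<le> K * (LINT x|M. (max 0 (\<sigma> * (u t x - c)))\<^sup>2)"
    unfolding m_def by blast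
qed

text \<open>Here \<open>lam t\<close>, a weighted mean of \<open>p (u t x)\<close>, may exceed \<open>p c\<close>, but only by a multiple of the
  integral of \<open>max 0 (\<sigma> * (u t x - c))\<close>.\<close>

lemma extremal_barrier:
  assumes \<sigma>: "\<bar>\<sigma>\<bar> = 1" and init: "AE x in M. \<sigma> * (u 0 x - c) \<le> 0" and "T \<ge> 0"
    and g_nonpos: "\<And>t. \<lbrakk>0 \<le> t; t \<le> T\<rbrakk> \<Longrightarrow> AE x in M. g (u t x) \<le> 0"
  shows "AE x in M. \<sigma> * (u T x - c) \<le> 0"
proof (rule barrier[OF \<sigma> init _ \<open>T \<ge> 0\<close>])
  define m where "m = (\<lambda>t x. max 0 (\<sigma> * (u t x - c)))"
  have p_sign: "\<sigma> * (p y - p c) \<ge> 0 \<longleftrightarrow> \<sigma> * (y - c) \<ge> 0" for y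
    using \<sigma> strict_mono_less_eq[OF p_mono, of y c] strict_mono_less_eq[OF p_mono, of c y]
    by (auto simp: abs_if split: if_splits)
  obtain R0 where R0: "R0 > 0" "\<forall>t\<in>{0..T}. AE x in M. \<bar>u t x\<bar> \<le> R0"
    using uniformly_bounded_on_Icc by blast
  define R where "R = max R0 \<bar>c\<bar>"
  obtain L where L: "L > 0" "\<forall>x\<in>{-R..R}. \<forall>y\<in>{-R..R}. \<bar>p x - p y\<bar> \<le> L * \<bar>x - y\<bar>"
    using C1_lipschitz_on_Icc[OF p_deriv p'_cont] by blast
  obtain G where G: "G > 0" "\<forall>y\<in>{-R..R}. \<bar>g y\<bar> \<le> G"
    using continuous_bounded_on_Icc[OF g_cont] by blast
  obtain a where a: "a > 0" "\<forall>t\<in>{0..T}. a \<le> \<bar>A t\<bar>" using A_bounded_below by blast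
  have "(LINT x|M. \<sigma> * m t x * w t x)
      \<le> G * (G * L / a) * measure M (space M) * (LINT x|M. (m t x)\<^sup>2)"
    if t: "t \<in> {0..T}" for t
  proof -
    have t0: "t \<ge> 0" using t by simp
    have gt: "AE x in M. g (u t x) \<le> 0" using g_nonpos[of t] t by simp
    have range: "AE x in M. u t x \<in> {-R..R} \<and> g (u t x) \<le> 0"
      using R0(2)[rule_format, OF t] gt
      by eventually_elim (auto simp: R_def)
    have c: "c \<in> {-R..R}" by (auto simp: R_def)
    have m_cont: "continuous_on UNIV (\<lambda>y. max 0 (\<sigma> * (y - c)))" by (intro continuous_intros)
    have m_Linf: "m t \<in> Linf M" unfolding m_def by (rule Linf_compose[OF u_Linf[OF t0] m_cont])
    have m_int: "integrable M (m t)" by (rule Linf_integrable[OF m_Linf])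
    have m_nonneg: "m t x \<ge> 0" for x by (simp add: m_def)
    define I where "I = (LINT x|M. m t x)"
    have "I \<ge> 0" unfolding I_def using m_nonneg by simp
    \<comment> \<open>Multiplication by \<open>- A t > 0\<close> turns the left side into the
      integral of \<open>- g (u t x) * (\<sigma> * (p (u t x) - p c))\<close>. As \<open>p\<close>
      is increasing, this integrand can be positive only beyond the level \<open>c\<close>, where it
      is at most \<open>G * L * m t x\<close>. Finally \<open>- A t\<close> is replaced by its lower
      bound \<open>a\<close>.\<close>
    have excess: "\<sigma> * (lam t - p c) \<le> G * L / a * I"
    proof -
      have "(LINT x|M. - g (u t x)) \<ge> 0"
        using gt by (intro integral_nonneg_AE) (auto elim!: eventually_mono)
      then have "A t \<le> 0" by (simp add: A_def)
      then have A: "A t < 0" "a \<le> - A t" using A_nonzero[OF t0] a(2)[rule_format, OF t] by auto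
      have "\<sigma> * (lam t - p c) * - A t = \<sigma> * p c * A t - \<sigma> * B t"
        using A by (simp add: lam_def field_simps)
      also have "\<dots> = (LINT x|M. - g (u t x) * (\<sigma> * (p (u t x) - p c)))"
      proof -
        have "(LINT x|M. - g (u t x) * (\<sigma> * (p (u t x) - p c)))
            = (LINT x|M. \<sigma> * p c * g (u t x) - \<sigma> * (g (u t x) * p (u t x)))"
          by (intro Bochner_Integration.integral_cong) (auto simp: algebra_simps)
        also have "\<dots> = \<sigma> * p c * A t - \<sigma> * B t"
          using integrable_compose[OF t0 gp_cont] integrable_compose[OF t0 g_cont]
          by (simp add: A_def B_def)
        finally show ?thesis by simp
      qed
      also have "\<dots> \<le> (LINT x|M. G * L * m t x)"
      proof (rule integral_mono_AE)
        show "integrable M (\<lambda>x. - g (u t x) * (\<sigma> * (p (u t x) - p c)))"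
          by (rule integrable_compose[OF t0, where h = "\<lambda>y. - g y * (\<sigma> * (p y - p c))"])
            (intro continuous_intros g_cont p_cont)
        show "integrable M (\<lambda>x. G * L * m t x)" using m_int by simp
        show "AE x in M. - g (u t x) * (\<sigma> * (p (u t x) - p c)) \<le> G * L * m t x"
          using range
        proof eventually_elim
          case (elim x)
          then have g: "0 \<le> - g (u t x)" "- g (u t x) \<le> G" using G(2) by force+
          have "\<sigma> * (p (u t x) - p c) \<le> L * m t x"
          proof (cases "\<sigma> * (u t x - c) \<ge> 0")
            case True
            then have "m t x = \<bar>u t x - c\<bar>"
              using \<sigma> by (auto simp: m_def abs_if split: if_splits)
            moreover have "\<sigma> * (p (u t x) - p c) \<le> \<bar>p (u t x) - p c\<bar>"
              using abs_ge_self[of "\<sigma> * (p (u t x) - p c)"] \<sigma> by (simp add: abs_mult)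
            ultimately show ?thesis using L(2) elim c by fastforce
          next
            case False
            then show ?thesis using p_sign[of "u t x"] m_nonneg[of x] L(1)
              by (smt (verit) mult_nonneg_nonneg)
          qed
          then have "- g (u t x) * (\<sigma> * (p (u t x) - p c)) \<le> - g (u t x) * (L * m t x)"
            using g by (intro mult_left_mono)
          also have "\<dots> \<le> G * (L * m t x)" using g L(1) m_nonneg by (intro mult_right_mono) auto
          finally show ?case by (simp add: mult.assoc)
        qed
      qed
      also have "\<dots> = G * L * I" by (simp add: I_def)
      finally have 1: "\<sigma> * (lam t - p c) * - A t \<le> G * L * I" .
      show ?thesis
      proof (cases "\<sigma> * (lam t - p c) \<le> 0")
        case True
        moreover have "0 \<le> G * L / a * I" using G L a \<open>I \<ge> 0\<close> by simp
        ultimately show ?thesis by linarith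
      next
        case False
        then have "\<sigma> * (lam t - p c) * a \<le> \<sigma> * (lam t - p c) * - A t"
          using A(2) by (intro mult_left_mono) auto
        with 1 a(1) show ?thesis by (simp add: field_simps)
      qed
    qed
    have "(LINT x|M. \<sigma> * m t x * w t x) \<le> (LINT x|M. G * (G * L / a * I) * m t x)"
    proof (rule integral_mono_AE)
      show "integrable M (\<lambda>x. \<sigma> * m t x * w t x)"
        unfolding m_def using t
        by (intro integrable_compose_mult_w[where h = "\<lambda>y. \<sigma> * max 0 (\<sigma> * (y - c))"])
          (auto intro!: continuous_intros)
      show "integrable M (\<lambda>x. G * (G * L / a * I) * m t x)" using m_int by simp
      show "AE x in M. \<sigma> * m t x * w t x \<le> G * (G * L / a * I) * m t x"
        using range
      proof eventually_elim
        case (elim x)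
        then have g: "0 \<le> - g (u t x)" "- g (u t x) \<le> G" using G(2) by force+
        show ?case
        proof (cases "\<sigma> * (u t x - c) \<ge> 0")
          case True
          have "\<sigma> * w t x = - g (u t x) * (\<sigma> * (lam t - p c) - \<sigma> * (p (u t x) - p c))"
            by (simp add: w_def algebra_simps)
          also have "\<dots> \<le> - g (u t x) * (G * L / a * I)"
            using g excess p_sign[of "u t x"] True by (intro mult_left_mono) linarith+
          also have "\<dots> \<le> G * (G * L / a * I)"
            using g G L a \<open>I \<ge> 0\<close> by (intro mult_right_mono) auto
          finally have "(\<sigma> * w t x) * m t x \<le> G * (G * L / a * I) * m t x"
            by (rule mult_right_mono) (rule m_nonneg)
          then show ?thesis by (simp add: mult_ac)
        qed (simp add: m_def)
      qed
    qed
    \<comment> \<open>One factor \<open>I\<close> comes from the excess of \<open>lam t\<close>, the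
      other from integrating \<open>m t\<close>; \<open>square_integral_le\<close> converts their
      product into the squared excess that Gronwall's inequality controls.\<close>
    also have "\<dots> = G * (G * L / a) * I\<^sup>2" by (simp add: I_def power2_eq_square)
    also have "\<dots> \<le> G * (G * L / a) * (measure M (space M) * (LINT x|M. (m t x)\<^sup>2))"
      using square_integral_le[OF m_Linf] G L a unfolding I_def by (intro mult_left_mono) auto
    finally show ?thesis by (simp add: mult.assoc)
  qed
  then show "\<exists>K. \<forall>t\<in>{0..T}. (LINT x|M. \<sigma> * max 0 (\<sigma> * (u t x - c)) * w t x)
      \<le> K * (LINT x|M. (max 0 (\<sigma> * (u t x - c)))\<^sup>2)"
    unfolding m_def by blast
qed

end

section \<open>Dissipation and limit points\<close>

lemma lipschitz_on_mult_bounded: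
  fixes f g :: "'b::metric_space \<Rightarrow> real"
  assumes f: "K-lipschitz_on S f" "\<And>x. x \<in> S \<Longrightarrow> \<bar>f x\<bar> \<le> F"
    and g: "L-lipschitz_on S g" "\<And>x. x \<in> S \<Longrightarrow> \<bar>g x\<bar> \<le> G"
  shows "(\<bar>F\<bar> * L + \<bar>G\<bar> * K)-lipschitz_on S (\<lambda>x. f x * g x)"
proof (rule lipschitz_onI)
  show "0 \<le> \<bar>F\<bar> * L + \<bar>G\<bar> * K"
    using lipschitz_on_nonneg[OF f(1)] lipschitz_on_nonneg[OF g(1)] by simp
  fix x y assume xy: "x \<in> S" "y \<in> S"
  have "f x * g x - f y * g y = f x * (g x - g y) + g y * (f x - f y)" by (simp add: algebra_simps)
  then have "\<bar>f x * g x - f y * g y\<bar> \<le> \<bar>f x\<bar> * \<bar>g x - g y\<bar> + \<bar>g y\<bar> * \<bar>f x - f y\<bar>"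
    by (metis abs_mult abs_triangle_ineq)
  also have "\<dots> \<le> \<bar>F\<bar> * (L * dist x y) + \<bar>G\<bar> * (K * dist x y)"
    using lipschitz_onD[OF f(1) xy] lipschitz_onD[OF g(1) xy] f(2)[OF xy(1)] g(2)[OF xy(2)]
    by (intro add_mono mult_mono) (auto simp: dist_real_def)
  finally show "dist (f x * g x) (f y * g y) \<le> (\<bar>F\<bar> * L + \<bar>G\<bar> * K) * dist x y"
    by (simp add: dist_real_def algebra_simps)
qed

text \<open>Where \<open>f n x \<le> c\<close>, the excess of \<open>\<phi> x\<close> over
  \<open>c\<close> is at most \<open>\<bar>f n x - \<phi> x\<bar>\<close>, so its integral is
  bounded by a null sequence.\<close>

lemma L1_limit_AE_le:
  fixes f :: "nat \<Rightarrow> 'a \<Rightarrow> real"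
  assumes "\<And>n. integrable M (f n)" "integrable M \<phi>"
    and lim: "(\<lambda>n. LINT x|M. \<bar>f n x - \<phi> x\<bar>) \<longlonglongrightarrow> 0" and le: "\<And>n. AE x in M. f n x \<le> c"
  shows "AE x in M. \<phi> x \<le> c"
proof -
  \<comment> \<open>The measure is arbitrary here, so constants may fail to be integrable; the
    excess over \<open>c\<close> is dominated by the excess over \<open>f 0\<close> instead.\<close>
  have int: "integrable M (\<lambda>x. max 0 (\<phi> x - f 0 x))" using assms by auto
  have dom: "AE x in M. max 0 (\<phi> x - c) \<le> max 0 (\<phi> x - f 0 x)"
    using le[of 0] by eventually_elim auto
  have int': "integrable M (\<lambda>x. max 0 (\<phi> x - c))"
    by (rule Bochner_Integration.integrable_bound[OF int])
      (use assms dom in \<open>auto elim!: eventually_mono\<close>)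
  have "(LINT x|M. max 0 (\<phi> x - c)) \<le> (LINT x|M. \<bar>f n x - \<phi> x\<bar>)" for n
  proof (rule integral_mono_AE[OF int'])
    show "AE x in M. max 0 (\<phi> x - c) \<le> \<bar>f n x - \<phi> x\<bar>"
      using le[of n] by eventually_elim auto
  qed (use assms in auto)
  then have "(LINT x|M. max 0 (\<phi> x - c)) \<le> 0"
    using lim by (intro LIMSEQ_le_const) auto
  then have "(LINT x|M. max 0 (\<phi> x - c)) = 0" by (intro antisym) auto
  then have "AE x in M. max 0 (\<phi> x - c) = 0"
    using int' by (subst (asm) integral_nonneg_eq_0_iff_AE) auto
  then show ?thesis by eventually_elim (auto simp: max_def split: if_splits)
qed

text \<open>The range stays in a fixed interval, on which \<open>g\<close> has the sign
  \<open>\<tau>\<close>: \<open>1\<close> under \<open>H2\<close>, \<open>-1\<close> under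
  \<open>H1\<close> and \<open>H3\<close>. This makes the constants below uniform in time.\<close>

locale confined_flow = nonlocal_flow +
  fixes a b \<tau> :: real
  assumes confined: "t \<ge> 0 \<Longrightarrow> AE x in M. u t x \<in> {a..b}"
    and \<tau>: "\<bar>\<tau>\<bar> = 1" and g_sign: "y \<in> {a..b} \<Longrightarrow> \<tau> * g y \<ge> 0"
begin

definition C :: "real \<Rightarrow> real" where "C t = (LINT x|M. g (u t x) * (p (u t x))\<^sup>2)"

text \<open>The defect in the Cauchy-Schwarz inequality for \<open>p (u t)\<close> against the weight \<open>g (u t)\<close>.\<close>

definition Q :: "real \<Rightarrow> real" where "Q t = A t * C t - (B t)\<^sup>2"

lemma gpp_deriv:
  "((\<lambda>y. g y * (p y)\<^sup>2) has_real_derivative g' y * (p y)\<^sup>2 + g y * (2 * p y * p' y)) (at y)"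
  by (auto intro!: derivative_eq_intros g_deriv p_deriv)

lemma gpp'_cont: "continuous_on UNIV (\<lambda>y. g' y * (p y)\<^sup>2 + g y * (2 * p y * p' y))"
  by (intro continuous_intros g_cont p_cont g'_cont p'_cont)

lemma gpp_cont: "continuous_on UNIV (\<lambda>y. g y * (p y)\<^sup>2)"
  by (intro continuous_intros g_cont p_cont)

lemma abs_integral_compose_le:
  fixes h :: "real \<Rightarrow> real"
  assumes "t \<ge> 0" "\<forall>y\<in>{a..b}. \<bar>h y\<bar> \<le> D" "D \<ge> 0"
  shows "\<bar>LINT x|M. h (u t x)\<bar> \<le> D * measure M (space M)"
proof (rule abs_integral_le)
  show "AE x in M. \<bar>h (u t x)\<bar> \<le> D"
    using confined[OF assms(1)] by eventually_elim (use assms in auto)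
qed fact

lemma integral_bounded:
  fixes h :: "real \<Rightarrow> real"
  assumes "continuous_on UNIV h"
  shows "\<exists>K>0. \<forall>t\<ge>0. \<bar>LINT x|M. h (u t x)\<bar> \<le> K"
proof -
  obtain D where D: "D > 0" "\<forall>y\<in>{a..b}. \<bar>h y\<bar> \<le> D"
    using continuous_bounded_on_Icc[OF assms] by blast
  then have "\<bar>LINT x|M. h (u t x)\<bar> \<le> D * measure M (space M) + 1" if "t \<ge> 0" for t
    using abs_integral_compose_le[OF that D(2)] by simp
  moreover have "D * measure M (space M) + 1 > 0" using D by (simp add: add_nonneg_pos)
  ultimately show ?thesis by blast
qed

text \<open>With a weight of one sign, the mean of \<open>p (u t x)\<close> cannot exceed the
  maximum of \<open>\<bar>p\<bar>\<close> on \<open>{a..b}\<close>. The bound survives even if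
  \<open>A t\<close> tends to zero.\<close>

lemma lam_uniformly_bounded: "\<exists>K>0. \<forall>t\<ge>0. \<bar>lam t\<bar> \<le> K"
proof -
  obtain P where P: "P > 0" "\<forall>y\<in>{a..b}. \<bar>p y\<bar> \<le> P"
    using continuous_bounded_on_Icc[OF p_cont] by blast
  have "\<bar>lam t\<bar> \<le> P" if t: "t \<ge> 0" for t
  proof -
    have "\<bar>B t\<bar> \<le> (LINT x|M. \<bar>g (u t x) * p (u t x)\<bar>)"
      unfolding B_def by (rule integral_abs_bound)
    also have "\<dots> \<le> (LINT x|M. P * (\<tau> * g (u t x)))"
    proof (rule integral_mono_AE)
      show "integrable M (\<lambda>x. \<bar>g (u t x) * p (u t x)\<bar>)"
        using integrable_compose[OF t gp_cont] by simp
      show "integrable M (\<lambda>x. P * (\<tau> * g (u t x)))"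
        using integrable_compose[OF t g_cont] by simp
      show "AE x in M. \<bar>g (u t x) * p (u t x)\<bar> \<le> P * (\<tau> * g (u t x))"
        using confined[OF t]
      proof eventually_elim
        case (elim x)
        have "\<bar>g (u t x)\<bar> = \<tau> * g (u t x)"
          using g_sign[OF elim] \<tau> by (metis abs_mult abs_of_nonneg mult_1)
        with elim P(2) g_sign[OF elim] show ?case
          by (simp add: abs_mult mult.commute[of P]) (intro mult_left_mono, auto)
      qed
    qed
    also have "\<dots> = P * (\<tau> * A t)" by (simp add: A_def)
    also have "\<dots> \<le> P * \<bar>A t\<bar>"
      using \<tau> P(1) abs_ge_self[of "\<tau> * A t"] by (intro mult_left_mono) (auto simp: abs_mult)
    finally show ?thesis using A_nonzero[OF t] by (simp add: lam_def divide_le_eq)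
  qed
  with P(1) show ?thesis by blast
qed

lemma w_uniformly_bounded: "\<exists>W\<ge>0. \<forall>t\<ge>0. AE x in M. \<bar>w t x\<bar> \<le> W"
proof -
  obtain P where P: "P > 0" "\<forall>y\<in>{a..b}. \<bar>p y\<bar> \<le> P"
    using continuous_bounded_on_Icc[OF p_cont] by blast
  obtain G where G: "G > 0" "\<forall>y\<in>{a..b}. \<bar>g y\<bar> \<le> G"
    using continuous_bounded_on_Icc[OF g_cont] by blast
  obtain K where K: "K > 0" "\<forall>t\<ge>0. \<bar>lam t\<bar> \<le> K" using lam_uniformly_bounded by blast
  have "AE x in M. \<bar>w t x\<bar> \<le> G * (P + K)" if t: "t \<ge> 0" for t
    using confined[OF t]
  proof eventually_elim
    case (elim x)
    have "\<bar>p (u t x) - lam t\<bar> \<le> P + K"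
      using P(2)[rule_format, OF elim] K(2)[rule_format, OF t] by linarith
    then show ?case
      unfolding w_def abs_mult using G elim by (intro mult_mono) auto
  qed
  moreover have "G * (P + K) \<ge> 0" using G P K by simp
  ultimately show ?thesis by blast
qed

text \<open>The speed \<open>w\<close> is bounded uniformly in time, hence so is the time derivative
  of the integral.\<close>

lemma integral_lipschitz:
  assumes h: "\<And>y. (h has_real_derivative h' y) (at y)" "continuous_on UNIV h'"
  shows "\<exists>L. L-lipschitz_on {0..} (\<lambda>t. LINT x|M. h (u t x))"
proof -
  obtain W where W: "W \<ge> 0" "\<forall>t\<ge>0. AE x in M. \<bar>w t x\<bar> \<le> W" using w_uniformly_bounded by blast
  obtain D where D: "D > 0" "\<forall>y\<in>{a..b}. \<bar>h' y\<bar> \<le> D"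
    using continuous_bounded_on_Icc[OF h(2)] by blast
  let ?L = "D * W * measure M (space M)"
  have bd: "norm (LINT x|M. h' (u t x) * w t x) \<le> ?L" if t: "t \<ge> 0" for t
    unfolding real_norm_def
  proof (rule abs_integral_le)
    show "AE x in M. \<bar>h' (u t x) * w t x\<bar> \<le> D * W"
      using confined[OF t] W(2)[rule_format, OF t]
      by eventually_elim (use D in \<open>auto simp: abs_mult intro!: mult_mono\<close>)
    show "0 \<le> D * W" using D W by simp
  qed
  have "?L-lipschitz_on {0..} (\<lambda>t. LINT x|M. h (u t x))"
  proof (rule lipschitz_onI)
    fix s t :: real assume st: "s \<in> {0..}" "t \<in> {0..}"
    show "dist (LINT x|M. h (u s x)) (LINT x|M. h (u t x)) \<le> ?L * dist s t"
      unfolding dist_norm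
    proof (rule field_differentiable_bound[where S = "{0..}" and f = "\<lambda>t. LINT x|M. h (u t x)"
          and f' = "\<lambda>z. LINT x|M. h' (u z x) * w z x"])
      show "((\<lambda>t. LINT x|M. h (u t x)) has_real_derivative (LINT x|M. h' (u z x) * w z x))
          (at z within {0..})" if "z \<in> {0..}" for z
        using integral_has_derivative[OF h] that by simp
    qed (use bd st in auto)
  qed (use D W in simp)
  then show ?thesis ..
qed

text \<open>\<open>Q\<close> is the entropy production multiplied by \<open>A\<close>. Without the
  denominator it is a polynomial in bounded Lipschitz functions of time, and its Lipschitz constant
  involves no lower bound on \<open>\<bar>A t\<bar>\<close>.\<close>

lemma Q_lipschitz: "\<exists>L. L-lipschitz_on {0..} Q"
proof -
  obtain LA LB LC where lip: "LA-lipschitz_on {0..} A" "LB-lipschitz_on {0..} B" "LC-lipschitz_on {0..} C"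
    using integral_lipschitz[OF g_deriv g'_cont] integral_lipschitz[OF gp_deriv gp'_cont]
      integral_lipschitz[OF gpp_deriv gpp'_cont]
    unfolding A_def[abs_def] B_def[abs_def] C_def[abs_def] by blast
  obtain KA KB KC where bd: "\<forall>t\<ge>0. \<bar>A t\<bar> \<le> KA" "\<forall>t\<ge>0. \<bar>B t\<bar> \<le> KB" "\<forall>t\<ge>0. \<bar>C t\<bar> \<le> KC"
    using integral_bounded[OF g_cont] integral_bounded[OF gp_cont] integral_bounded[OF gpp_cont]
    unfolding A_def[abs_def] B_def[abs_def] C_def[abs_def] by blast
  have "Q = (\<lambda>t. A t * C t - B t * B t)" by (simp add: Q_def fun_eq_iff power2_eq_square)
  moreover have "\<exists>L. L-lipschitz_on {0..} (\<lambda>t. A t * C t - B t * B t)"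
  proof (rule exI)
    show "((\<bar>KA\<bar> * LC + \<bar>KC\<bar> * LA) + (\<bar>KB\<bar> * LB + \<bar>KB\<bar> * LB))-lipschitz_on {0..}
        (\<lambda>t. A t * C t - B t * B t)"
      using bd by (intro lipschitz_on_diff lipschitz_on_mult_bounded lip) auto
  qed
  ultimately show ?thesis by simp
qed

text \<open>Since \<open>w t\<close> has mean zero, \<open>lam t\<close> may be subtracted from the
  factor \<open>p (u t x)\<close>, which leaves the integral of
  \<open>g (u t x) * (p (u t x) - lam t)^2\<close>, of sign \<open>\<tau>\<close>. Both integrals
  are expanded to \<open>C t - lam t * B t\<close>.\<close>

lemma entropy_dissipation:
  assumes "t \<ge> 0"
  shows "\<tau> * (LINT x|M. p (u t x) * w t x) \<ge> 0"
    and "A t * (LINT x|M. p (u t x) * w t x) = Q t"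
proof -
  note [simp] = integrable_compose[OF assms gp_cont] integrable_compose[OF assms g_cont]
    integrable_compose[OF assms gpp_cont]
  have "(LINT x|M. p (u t x) * w t x)
      = (LINT x|M. g (u t x) * (p (u t x))\<^sup>2 - lam t * (g (u t x) * p (u t x)))"
    by (intro Bochner_Integration.integral_cong) (auto simp: w_def power2_eq_square algebra_simps)
  also have "\<dots> = C t - lam t * B t" by (simp add: C_def B_def)
  finally have eq: "(LINT x|M. p (u t x) * w t x) = C t - lam t * B t" .
  with A_nonzero[OF assms] show "A t * (LINT x|M. p (u t x) * w t x) = Q t"
    by (simp add: Q_def lam_def power2_eq_square right_diff_distrib)
  have "(LINT x|M. g (u t x) * (p (u t x) - lam t)\<^sup>2)
      = (LINT x|M. g (u t x) * (p (u t x))\<^sup>2 - 2 * lam t * (g (u t x) * p (u t x))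
          + (lam t)\<^sup>2 * g (u t x))"
    by (intro Bochner_Integration.integral_cong) (auto simp: power2_eq_square algebra_simps)
  also have "\<dots> = C t - 2 * lam t * B t + (lam t)\<^sup>2 * A t" by (simp add: C_def B_def A_def)
  also have "\<dots> = C t - lam t * B t"
    using A_nonzero[OF assms] by (simp add: lam_def power2_eq_square)
  finally have "\<tau> * (LINT x|M. p (u t x) * w t x) = (LINT x|M. \<tau> * (g (u t x) * (p (u t x) - lam t)\<^sup>2))"
    using eq by simp
  also have "\<dots> \<ge> 0"
  proof (rule integral_nonneg_AE)
    show "AE x in M. 0 \<le> \<tau> * (g (u t x) * (p (u t x) - lam t)\<^sup>2)"
      using confined[OF assms]
      by eventually_elim (use g_sign in \<open>auto simp: mult.assoc[symmetric] intro!: mult_nonneg_nonneg\<close>)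
  qed
  finally show "\<tau> * (LINT x|M. p (u t x) * w t x) \<ge> 0" .
qed

text \<open>The entropy is \<open>\<tau>\<close> times the integral of \<open>F (u t x)\<close>,
  with \<open>F\<close> an antiderivative of \<open>p\<close>. It is bounded because the flow is
  confined, and \<open>\<bar>Q\<bar>\<close> is at most \<open>KA\<close> times its derivative, so
  \<open>dissipation_tends_to_zero\<close> applies.\<close>

lemma Q_limit_zero:
  assumes "\<And>n. 0 \<le> t n" "filterlim t at_top sequentially" "(\<lambda>n. Q (t n)) \<longlonglongrightarrow> q"
  shows "q = 0"
proof -
  have "\<exists>F. \<forall>y::real. -\<infinity> < ereal y \<longrightarrow> ereal y < \<infinity> \<longrightarrow> (F has_vector_derivative p y) (at y)"
    using p_deriv DERIV_isCont by (intro einterval_antiderivative) auto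
  then obtain F where F: "\<And>y. (F has_real_derivative p y) (at y)"
    by (auto simp: has_real_derivative_iff_has_vector_derivative)
  then have F_cont: "continuous_on UNIV F"
    by (meson DERIV_isCont continuous_at_imp_continuous_on)
  obtain K where K: "K > 0" "\<forall>t\<ge>0. \<bar>LINT x|M. F (u t x)\<bar> \<le> K"
    using integral_bounded[OF F_cont] by blast
  obtain KA where KA: "KA > 0" "\<forall>t\<ge>0. \<bar>A t\<bar> \<le> KA"
    using integral_bounded[OF g_cont] unfolding A_def by blast
  obtain L where L: "L-lipschitz_on {0..} Q" using Q_lipschitz by blast
  show ?thesis
  proof (rule dissipation_tends_to_zero[OF _ _ _ KA(1) L assms])
    fix s :: real assume s: "s \<ge> 0"
    show "((\<lambda>t. \<tau> * (LINT x|M. F (u t x))) has_real_derivative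
        \<tau> * (LINT x|M. p (u s x) * w s x)) (at s within {0..})"
      by (intro DERIV_cmult integral_has_derivative[OF F p_cont s])
    show "\<tau> * (LINT x|M. F (u s x)) \<le> K"
      using K(2)[rule_format, OF s] \<tau> abs_ge_self[of "\<tau> * (LINT x|M. F (u s x))"]
      by (simp add: abs_mult)
    have "\<bar>Q s\<bar> = \<bar>A s\<bar> * \<bar>\<tau> * (LINT x|M. p (u s x) * w s x)\<bar>"
      using entropy_dissipation(2)[OF s] \<tau> by (simp add: abs_mult[symmetric] abs_mult[of \<tau>])
    also have "\<dots> \<le> KA * (\<tau> * (LINT x|M. p (u s x) * w s x))"
      using entropy_dissipation(1)[OF s] KA(2)[rule_format, OF s]
      by (intro mult_mono) auto
    finally show "\<bar>Q s\<bar> \<le> KA * (\<tau> * (LINT x|M. p (u s x) * w s x))" .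
  qed
qed

end

section \<open>Limit points of a confined flow\<close>

locale limit_point = confined_flow +
  fixes \<phi> :: "'a \<Rightarrow> real" and t :: "nat \<Rightarrow> real"
  assumes phi_integrable: "integrable M \<phi>"
    and t_nonneg: "0 \<le> t n" and t_at_top: "filterlim t at_top sequentially"
    and L1_lim: "(\<lambda>n. LINT x|M. \<bar>u (t n) x - \<phi> x\<bar>) \<longlonglongrightarrow> 0"
begin

lemma u_t_integrable: "integrable M (u (t n))"
  by (rule Linf_integrable[OF u_Linf[OF t_nonneg]])

lemma phi_confined: "AE x in M. \<phi> x \<in> {a..b}"
proof -
  have "AE x in M. \<phi> x \<le> b"
    by (rule L1_limit_AE_le[OF u_t_integrable phi_integrable L1_lim])
      (use confined[OF t_nonneg] in \<open>auto elim!: eventually_mono\<close>)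
  moreover have "AE x in M. - \<phi> x \<le> - a"
  proof (rule L1_limit_AE_le[where f = "\<lambda>n x. - u (t n) x"])
    show "(\<lambda>n. LINT x|M. \<bar>- u (t n) x - - \<phi> x\<bar>) \<longlonglongrightarrow> 0"
      using L1_lim by (simp add: abs_minus_commute)
    show "AE x in M. - u (t n) x \<le> - a" for n
      using confined[OF t_nonneg[of n]] by eventually_elim auto
  qed (use u_t_integrable phi_integrable in auto)
  ultimately show ?thesis by eventually_elim auto
qed

lemma phi_Linf: "\<phi> \<in> Linf M"
proof (rule Linf_I)
  show "AE x in M. \<bar>\<phi> x\<bar> \<le> \<bar>a\<bar> + \<bar>b\<bar>" using phi_confined by eventually_elim auto
qed (use phi_integrable in auto)

lemma phi_integrable_compose:
  fixes h :: "real \<Rightarrow> real"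
  assumes "continuous_on UNIV h" shows "integrable M (\<lambda>x. h (\<phi> x))"
  by (rule Linf_integrable[OF Linf_compose[OF phi_Linf assms]])

text \<open>\<open>h\<close> is Lipschitz on \<open>{a..b}\<close>, where \<open>u (t n)\<close> and
  \<open>\<phi>\<close> both take their values almost everywhere, so convergence in L^1 passes
  through \<open>h\<close>.\<close>

lemma integral_limit:
  assumes h: "\<And>y. (h has_real_derivative h' y) (at y)" "continuous_on UNIV h'"
  shows "(\<lambda>n. LINT x|M. h (u (t n) x)) \<longlonglongrightarrow> (LINT x|M. h (\<phi> x))"
proof -
  have h_cont: "continuous_on UNIV h"
    using h(1) by (meson DERIV_isCont continuous_at_imp_continuous_on)
  obtain L where L: "L > 0" "\<forall>x\<in>{a..b}. \<forall>y\<in>{a..b}. \<bar>h x - h y\<bar> \<le> L * \<bar>x - y\<bar>"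
    using C1_lipschitz_on_Icc[OF h] by blast
  note int = integrable_compose[OF t_nonneg h_cont] phi_integrable_compose[OF h_cont]
  have "norm ((LINT x|M. h (u (t n) x)) - (LINT x|M. h (\<phi> x)))
      \<le> L * (LINT x|M. \<bar>u (t n) x - \<phi> x\<bar>)" for n
  proof -
    have "norm ((LINT x|M. h (u (t n) x)) - (LINT x|M. h (\<phi> x)))
        = \<bar>LINT x|M. h (u (t n) x) - h (\<phi> x)\<bar>"
      using int by simp
    also have "\<dots> \<le> (LINT x|M. \<bar>h (u (t n) x) - h (\<phi> x)\<bar>)" by (rule integral_abs_bound)
    also have "\<dots> \<le> (LINT x|M. L * \<bar>u (t n) x - \<phi> x\<bar>)"
    proof (rule integral_mono_AE)
      show "AE x in M. \<bar>h (u (t n) x) - h (\<phi> x)\<bar> \<le> L * \<bar>u (t n) x - \<phi> x\<bar>"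
        using confined[OF t_nonneg[of n]] phi_confined by eventually_elim (use L(2) in blast)
    qed (use int u_t_integrable phi_integrable in auto)
    finally show ?thesis by simp
  qed
  moreover have "(\<lambda>n. L * (LINT x|M. \<bar>u (t n) x - \<phi> x\<bar>)) \<longlonglongrightarrow> 0"
    using tendsto_mult_right_zero[OF L1_lim] by simp
  ultimately have "(\<lambda>n. (LINT x|M. h (u (t n) x)) - (LINT x|M. h (\<phi> x))) \<longlonglongrightarrow> 0"
    by (rule Lim_null_comparison[OF always_eventually[OF allI]])
  then show ?thesis by (simp add: LIM_zero_iff)
qed

lemma phi_mass: "(LINT x|M. \<phi> x) = (LINT x|M. u 0 x)"
proof -
  have "(\<lambda>n. LINT x|M. u (t n) x) \<longlonglongrightarrow> (LINT x|M. \<phi> x)"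
    by (rule integral_limit[where h' = "\<lambda>_. 1"]) (auto intro: derivative_intros)
  moreover have "(\<lambda>n. LINT x|M. u (t n) x) = (\<lambda>n. LINT x|M. u 0 x)"
    using mass_conserved[OF t_nonneg] by auto
  ultimately show ?thesis by (simp add: LIMSEQ_const_iff)
qed

text \<open>The equality case of Cauchy-Schwarz. In the limit \<open>A0 * C0 = B0^2\<close>; if
  \<open>A0\<close> is nonzero, the weighted variance of \<open>p (\<phi> x)\<close> around its mean
  \<open>l\<close> vanishes, so \<open>p (\<phi> x) = l\<close> wherever \<open>g (\<phi> x)\<close>
  is nonzero. If \<open>A0 = 0\<close>, the fixed sign of \<open>g\<close> already forces
  \<open>g (\<phi> x) = 0\<close>.\<close>

lemma phi_stationary: "\<exists>r. AE x in M. g (\<phi> x) = 0 \<or> \<phi> x = r"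
proof -
  define A0 where "A0 = (LINT x|M. g (\<phi> x))"
  define B0 where "B0 = (LINT x|M. g (\<phi> x) * p (\<phi> x))"
  define C0 where "C0 = (LINT x|M. g (\<phi> x) * (p (\<phi> x))\<^sup>2)"
  have "(\<lambda>n. Q (t n)) \<longlonglongrightarrow> A0 * C0 - B0\<^sup>2"
    unfolding Q_def A_def B_def C_def A0_def B0_def C0_def
    by (intro tendsto_intros integral_limit[OF g_deriv g'_cont] integral_limit[OF gp_deriv gp'_cont]
      integral_limit[OF gpp_deriv gpp'_cont])
  then have Q0: "A0 * C0 = B0\<^sup>2" using Q_limit_zero[OF t_nonneg t_at_top] by fastforce
  note [simp] = phi_integrable_compose[OF g_cont] phi_integrable_compose[OF gp_cont]
    phi_integrable_compose[OF gpp_cont]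
  show ?thesis
  proof (cases "A0 = 0")
    case True
    have "(LINT x|M. \<tau> * g (\<phi> x)) = 0" using True by (simp add: A0_def)
    moreover have "AE x in M. \<tau> * g (\<phi> x) \<ge> 0"
      using phi_confined by eventually_elim (rule g_sign)
    ultimately have "AE x in M. \<tau> * g (\<phi> x) = 0"
      by (subst (asm) integral_nonneg_eq_0_iff_AE) auto
    \<comment> \<open>The value 0 is a placeholder for \<open>r\<close>; the first alternative holds
      almost everywhere.\<close>
    then have "AE x in M. g (\<phi> x) = 0 \<or> \<phi> x = 0" using \<tau> by (auto elim!: eventually_mono)
    then show ?thesis by blast
  next
    case False
    define l where "l = B0 / A0"
    have "(LINT x|M. \<tau> * (g (\<phi> x) * (p (\<phi> x) - l)\<^sup>2))
        = \<tau> * (LINT x|M. g (\<phi> x) * (p (\<phi> x))\<^sup>2 - 2 * l * (g (\<phi> x) * p (\<phi> x)) + l\<^sup>2 * g (\<phi> x))"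
      by (subst integral_mult_right_zero[symmetric], intro Bochner_Integration.integral_cong)
        (auto simp: power2_eq_square algebra_simps)
    also have "\<dots> = \<tau> * (C0 - 2 * l * B0 + l\<^sup>2 * A0)" by (simp add: A0_def B0_def C0_def)
    also have "C0 = B0\<^sup>2 / A0" using Q0 False by (simp add: field_simps)
    also have "\<tau> * (B0\<^sup>2 / A0 - 2 * l * B0 + l\<^sup>2 * A0) = 0"
      using False by (simp add: l_def power2_eq_square)
    finally have zero: "(LINT x|M. \<tau> * (g (\<phi> x) * (p (\<phi> x) - l)\<^sup>2)) = 0" .
    have "integrable M (\<lambda>x. \<tau> * (g (\<phi> x) * (p (\<phi> x) - l)\<^sup>2))"
      by (rule phi_integrable_compose[where h = "\<lambda>y. \<tau> * (g y * (p y - l)\<^sup>2)"])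
        (intro continuous_intros g_cont p_cont)
    moreover have "AE x in M. \<tau> * (g (\<phi> x) * (p (\<phi> x) - l)\<^sup>2) \<ge> 0"
      using phi_confined
      by eventually_elim (use g_sign in \<open>auto simp: mult.assoc[symmetric] intro!: mult_nonneg_nonneg\<close>)
    ultimately have "AE x in M. \<tau> * (g (\<phi> x) * (p (\<phi> x) - l)\<^sup>2) = 0"
      using zero by (subst (asm) integral_nonneg_eq_0_iff_AE) auto
    then have ae: "AE x in M. g (\<phi> x) = 0 \<or> p (\<phi> x) = l" using \<tau> by (auto elim!: eventually_mono)
    \<comment> \<open>By injectivity \<open>p\<close> takes the value \<open>l\<close> at most once;
      if it never does, any \<open>r\<close> satisfies the implication.\<close>
    obtain r where "\<And>y. p y = l \<Longrightarrow> y = r"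
      using strict_mono_eq[OF p_mono] by metis
    with ae have "AE x in M. g (\<phi> x) = 0 \<or> \<phi> x = r" by (auto elim!: eventually_mono)
    then show ?thesis by blast
  qed
qed

end

section \<open>Step functions in the limit set\<close>

text \<open>On a space of positive measure the constant \<open>- d\<close> has essential supremum
  \<open>- d\<close>, which rules out the value \<open>-\<infinity>\<close>.\<close>

lemma esssup_eq_ereal:
  assumes "f \<in> Linf M" "emeasure M (space M) \<noteq> 0"
  obtains c where "esssup M (\<lambda>x. ereal (f x)) = ereal c" "AE x in M. f x \<le> c"
proof -
  have f: "f \<in> borel_measurable M" using assms by (simp add: Linf_def)
  obtain d where d: "AE x in M. \<bar>f x\<bar> \<le> d" using assms by (auto simp: Linf_iff)
  have le: "AE x in M. ereal (f x) \<le> esssup M (\<lambda>x. ereal (f x))" by (rule esssup_AE)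
  have "esssup M (\<lambda>x. ereal (f x)) \<le> ereal d"
    using f d by (intro esssup_I) (auto elim!: eventually_mono)
  moreover have "esssup M (\<lambda>x. ereal (- d)) \<le> esssup M (\<lambda>x. ereal (f x))"
    using d by (intro esssup_AE_mono) (auto elim!: eventually_mono)
  then have "ereal (- d) \<le> esssup M (\<lambda>x. ereal (f x))"
    using assms(2) by (simp add: esssup_const)
  ultimately obtain c where "esssup M (\<lambda>x. ereal (f x)) = ereal c"
    by (cases "esssup M (\<lambda>x. ereal (f x))") auto
  with le show ?thesis by (intro that[of c]) auto
qed

lemma essinf_eq_ereal:
  assumes "f \<in> Linf M" "emeasure M (space M) \<noteq> 0"
  obtains c where "essinf M (\<lambda>x. ereal (f x)) = ereal c" "AE x in M. c \<le> f x"
proof -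
  have "(\<lambda>x. - f x) \<in> Linf M" using Linf_cmult[OF assms(1), of "-1"] by simp
  from esssup_eq_ereal[OF this assms(2)] obtain c
    where c: "esssup M (\<lambda>x. ereal (- f x)) = ereal c" "AE x in M. - f x \<le> c" by blast
  then have "essinf M (\<lambda>x. ereal (f x)) = ereal (- c)" by (simp add: essinf_def)
  moreover have "AE x in M. - c \<le> f x" using c(2) by eventually_elim auto
  ultimately show ?thesis by (rule that)
qed

lemma sets_level:
  assumes "f \<in> borel_measurable (lebesgue_on S)" "S \<in> sets lebesgue"
  shows "{x \<in> S. f x = (c :: real)} \<in> sets lebesgue"
proof -
  have "{x \<in> space (lebesgue_on S). f x = c} \<in> sets (lebesgue_on S)"
    using assms(1) by measurable
  then show ?thesis using assms(2) by (auto simp: sets_restrict_space_iff)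
qed

text \<open>\<open>measure\<close> is 0 on sets of infinite measure too; boundedness excludes this,
  so the level set is a genuine null set.\<close>

lemma AE_not_level:
  assumes "S \<in> sets lebesgue" "{x \<in> S. f x = c} \<in> sets lebesgue" "bounded S"
    "measure lebesgue {x \<in> S. f x = c} = 0"
  shows "AE x in lebesgue_on S. f x \<noteq> c"
proof -
  have "{x \<in> S. f x = c} \<in> lmeasurable"
    using assms by (intro bounded_set_imp_lmeasurable) (auto intro: bounded_subset)
  then have "{x \<in> S. f x = c} \<in> null_sets lebesgue"
    using assms(2,4) by (intro null_setsI) (auto simp: emeasure_eq_measure2)
  then have "AE x in lebesgue. x \<notin> {x \<in> S. f x = c}" by (rule AE_not_in)
  then show ?thesis using assms(1) by (auto simp: AE_restrict_space_iff elim!: eventually_mono)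
qed

text \<open>For \<open>H1\<close> take \<open>c = 1\<close>, \<open>\<sigma> = 1\<close>; for \<open>H3\<close> take \<open>c = 0\<close>, \<open>\<sigma> = -1\<close>.\<close>

lemma (in nonlocal_flow) one_sided_limit:
  fixes \<sigma> c d :: real and \<phi> :: "'a \<Rightarrow> real"
  assumes \<sigma>: "\<bar>\<sigma>\<bar> = 1" and "g c = 0"
    and g_neg: "\<And>y. \<sigma> * (y - c) > 0 \<Longrightarrow> g y < 0"
    and init: "AE x in M. \<sigma> * (u 0 x - c) \<ge> 0" "\<not> (AE x in M. u 0 x = c)"
      "AE x in M. \<sigma> * (u 0 x - d) \<le> 0"
    and phi: "integrable M \<phi>" "\<And>n. 0 \<le> t n" "filterlim t at_top sequentially"
      "(\<lambda>n. LINT x|M. \<bar>u (t n) x - \<phi> x\<bar>) \<longlonglongrightarrow> 0"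
  shows "AE x in M. \<sigma> * (\<phi> x - c) \<ge> 0 \<and> \<sigma> * (\<phi> x - d) \<le> 0"
    and "\<exists>r. \<sigma> * (r - c) > 0 \<and> (AE x in M. \<phi> x = c \<or> \<phi> x = r) \<and> \<not> (AE x in M. \<phi> x \<noteq> r)"
proof -
  have g_nonpos: "g y \<le> 0" if "\<sigma> * (y - c) \<ge> 0" for y
  proof (cases "y = c")
    case False
    then have "\<sigma> * (y - c) > 0" using that \<sigma> by (auto simp: less_le)
    then show ?thesis using g_neg by force
  qed (use \<open>g c = 0\<close> in simp)
  \<comment> \<open>The zero \<open>c\<close> of \<open>g\<close> is a barrier on the side away from
    the data, hence \<open>-\<sigma>\<close>. Only then is \<open>g (u s x) \<le> 0\<close> known,
    which \<open>extremal_barrier\<close> requires for \<open>outer\<close>.\<close>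
  have inner: "AE x in M. \<sigma> * (u s x - c) \<ge> 0" if "s \<ge> 0" for s
    using zero_barrier[of "-\<sigma>" c s] \<sigma> \<open>g c = 0\<close> init(1) that by simp
  have outer: "AE x in M. \<sigma> * (u s x - d) \<le> 0" if "s \<ge> 0" for s
  proof (rule extremal_barrier[OF \<sigma> init(3) that])
    show "AE x in M. g (u t x) \<le> 0" if "0 \<le> t" for t
      using inner[OF that] by eventually_elim (rule g_nonpos)
  qed
  \<comment> \<open>For \<open>\<sigma> = -1\<close> the level \<open>c\<close> is the upper end of
    the interval, so the end points swap.\<close>
  define a b where "a = (if \<sigma> = 1 then c else d)" and "b = (if \<sigma> = 1 then d else c)"
  have ab: "y \<in> {a..b} \<longleftrightarrow> \<sigma> * (y - c) \<ge> 0 \<and> \<sigma> * (y - d) \<le> 0" for y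
    using \<sigma> by (auto simp: a_def b_def abs_if split: if_splits)
  interpret limit_point M u g g' p p' a b "-1" \<phi> t
  proof unfold_locales
    show "AE x in M. u s x \<in> {a..b}" if "s \<ge> 0" for s
      using inner[OF that] outer[OF that] by eventually_elim (use ab in blast)
    show "- 1 * g y \<ge> 0" if "y \<in> {a..b}" for y
      using g_nonpos[of y] ab[of y] that by simp
  qed (use phi in simp_all)
  show conf: "AE x in M. \<sigma> * (\<phi> x - c) \<ge> 0 \<and> \<sigma> * (\<phi> x - d) \<le> 0"
    using phi_confined by eventually_elim (use ab in blast)
  obtain r where "AE x in M. g (\<phi> x) = 0 \<or> \<phi> x = r" using phi_stationary by blast
  with conf have r: "AE x in M. \<phi> x = c \<or> \<phi> x = r"
  proof eventually_elim
    case (elim x)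
    then have "\<phi> x \<noteq> c \<Longrightarrow> \<sigma> * (\<phi> x - c) > 0" using \<sigma> by (auto simp: less_le)
    with elim show ?case using g_neg[of "\<phi> x"] by (metis less_irrefl)
  qed
  \<comment> \<open>Conservation of mass: if \<open>\<phi>\<close> were \<open>c\<close>, the
    nonnegative function \<open>\<sigma> * (u 0 x - c)\<close> would have integral 0, and the
    initial value would be \<open>c\<close>.\<close>
  have not_c: "\<not> (AE x in M. \<phi> x = c)"
  proof
    assume "AE x in M. \<phi> x = c"
    then have "(LINT x|M. \<phi> x) = (LINT x|M. c)"
      using phi(1) by (intro integral_cong_AE) auto
    then have "(LINT x|M. \<sigma> * (u 0 x - c)) = 0"
      using phi_mass Linf_integrable[OF u_Linf[of 0]] by (simp add: mult.commute)
    moreover have "integrable M (\<lambda>x. \<sigma> * (u 0 x - c))"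
      using Linf_integrable[OF u_Linf[of 0]] by simp
    ultimately have "AE x in M. \<sigma> * (u 0 x - c) = 0"
      using init(1) by (subst (asm) integral_nonneg_eq_0_iff_AE) auto
    then have "AE x in M. u 0 x = c" using \<sigma> by (auto elim!: eventually_mono)
    with init(2) show False by simp
  qed
  \<comment> \<open>Otherwise \<open>r\<close> is \<open>c\<close> or lies on the side that
    confinement excludes, and \<open>\<phi>\<close> would be \<open>c\<close> almost
    everywhere.\<close>
  have "\<sigma> * (r - c) > 0"
  proof (rule ccontr)
    assume "\<not> \<sigma> * (r - c) > 0"
    then have le: "\<sigma> * (r - c) \<le> 0" by simp
    have "AE x in M. \<phi> x = c"
      using r conf
    proof eventually_elim
      case (elim x)
      then have "\<phi> x = r \<Longrightarrow> \<sigma> * (r - c) = 0" using le by force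
      with elim show ?case using \<sigma> by auto
    qed
    with not_c show False by simp
  qed
  moreover have "\<not> (AE x in M. \<phi> x \<noteq> r)"
  proof
    assume "AE x in M. \<phi> x \<noteq> r"
    with r have "AE x in M. \<phi> x = c" by eventually_elim auto
    with not_c show False by simp
  qed
  ultimately show "\<exists>r. \<sigma> * (r - c) > 0 \<and> (AE x in M. \<phi> x = c \<or> \<phi> x = r) \<and> \<not> (AE x in M. \<phi> x \<noteq> r)"
    using r by blast
qed

text \<open>Both 0 and 1 are zeros of \<open>g\<close> and hence barriers, and between them
  \<open>g\<close> is nonnegative, so \<open>\<tau> = 1\<close>. The third value \<open>r\<close>
  may coincide with 0 or 1 or lie outside \<open>{0..1}\<close>.\<close>

lemma (in nonlocal_flow) two_sided_limit:
  fixes \<phi> :: "'a \<Rightarrow> real"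
  assumes g: "g 0 = 0" "g 1 = 0" "\<And>y. y \<in> {0<..<1} \<Longrightarrow> g y > 0"
    and init: "AE x in M. u 0 x \<in> {0..1}"
    and phi: "integrable M \<phi>" "\<And>n. 0 \<le> t n" "filterlim t at_top sequentially"
      "(\<lambda>n. LINT x|M. \<bar>u (t n) x - \<phi> x\<bar>) \<longlonglongrightarrow> 0"
  shows "AE x in M. \<phi> x \<in> {0..1}" and "\<exists>r. AE x in M. \<phi> x = 0 \<or> \<phi> x = 1 \<or> \<phi> x = r"
proof -
  interpret limit_point M u g g' p p' 0 1 1 \<phi> t
  proof unfold_locales
    show "AE x in M. u s x \<in> {0..1}" if "s \<ge> 0" for s
    proof -
      have upper: "AE x in M. 1 * (u 0 x - 1) \<le> 0" using init by eventually_elim auto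
      have "AE x in M. 1 * (u s x - 1) \<le> 0"
        by (rule zero_barrier[OF _ g(2) upper that]) simp
      moreover have lower: "AE x in M. (- 1) * (u 0 x - 0) \<le> 0" using init by eventually_elim auto
      have "AE x in M. (- 1) * (u s x - 0) \<le> 0"
        by (rule zero_barrier[OF _ g(1) lower that]) simp
      ultimately show ?thesis by eventually_elim auto
    qed
    show "1 * g y \<ge> 0" if "y \<in> {0..1}" for y
      using that g(3)[of y] g(1,2) by (cases "y = 0 \<or> y = 1") (auto simp: less_le)
  qed (use phi in simp_all)
  show conf: "AE x in M. \<phi> x \<in> {0..1}" by (rule phi_confined)
  obtain r where "AE x in M. g (\<phi> x) = 0 \<or> \<phi> x = r" using phi_stationary by blast
  with conf have "AE x in M. \<phi> x = 0 \<or> \<phi> x = 1 \<or> \<phi> x = r"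
  proof eventually_elim
    case (elim x)
    then show ?case using g(3)[of "\<phi> x"] by (cases "\<phi> x \<in> {0<..<1}") auto
  qed
  then show "\<exists>r. AE x in M. \<phi> x = 0 \<or> \<phi> x = 1 \<or> \<phi> x = r" by blast
qed

section \<open>The problem on \<open>\<Omega>\<close> and its three cases\<close>

lemma C1_differentiable_on_UNIV_realD:
  fixes f :: "real \<Rightarrow> real"
  assumes "f C1_differentiable_on UNIV"
  obtains f' where "\<And>y. (f has_real_derivative f' y) (at y)" "continuous_on UNIV f'"
  using assms unfolding C1_differentiable_on_def
  by (auto simp: has_real_derivative_iff_has_vector_derivative)

theorem theorem4p4:
  fixes \<Omega> :: "'a::euclidean_space set"
    and p g :: "real \<Rightarrow> real"
    and u0 \<phi> :: "'a \<Rightarrow> real"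
    and u :: "real \<Rightarrow> 'a \<Rightarrow> real"
  assumes "open \<Omega>" and "bounded \<Omega>"
    and "p C1_differentiable_on UNIV" and "strict_mono p"
    and "g C1_differentiable_on UNIV" and "g 0 = 0" and "g 1 = 0"
    and "\<And>s. s \<in> {0<..<1} \<Longrightarrow> g s > 0"
    and "\<And>s. s \<in> {..<0} \<union> {1<..} \<Longrightarrow> g s < 0"
    and "H1 \<Omega> u0 \<or> H2 \<Omega> g u0 \<or> H3 \<Omega> u0"
    and "solution_P \<Omega> g p u0 \<infinity> u"
    and "\<phi> \<in> omega_limit \<Omega> u"
  shows "(H1 \<Omega> u0 \<longrightarrow>
            (AE x in lebesgue_on \<Omega>. 1 \<le> \<phi> x \<and>
               ereal (\<phi> x) \<le> esssup (lebesgue_on \<Omega>) (\<lambda>y. ereal (u0 y))) \<and>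
            (\<exists>\<mu> A1. \<mu> > 1 \<and> A1 \<in> sets lebesgue \<and> A1 \<subseteq> \<Omega> \<and> measure lebesgue A1 \<noteq> 0 \<and>
               (AE x in lebesgue_on \<Omega>. \<phi> x = \<mu> * indicat_real A1 x + indicat_real (\<Omega> - A1) x)))
       \<and> (H2 \<Omega> g u0 \<longrightarrow>
            (AE x in lebesgue_on \<Omega>. 0 \<le> \<phi> x \<and> \<phi> x \<le> 1) \<and>
            (\<exists>\<nu> A1 A2. 0 < \<nu> \<and> \<nu> < 1 \<and> A1 \<in> sets lebesgue \<and> A2 \<in> sets lebesgue \<and>
               A1 \<union> A2 \<subseteq> \<Omega> \<and> A1 \<inter> A2 = {} \<and>
               (AE x in lebesgue_on \<Omega>. \<phi> x = indicat_real A1 x + \<nu> * indicat_real A2 x)))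
       \<and> (H3 \<Omega> u0 \<longrightarrow>
            (AE x in lebesgue_on \<Omega>.
               essinf (lebesgue_on \<Omega>) (\<lambda>y. ereal (u0 y)) \<le> ereal (\<phi> x) \<and> \<phi> x \<le> 0) \<and>
            (\<exists>\<xi> A1. \<xi> < 0 \<and> A1 \<in> sets lebesgue \<and> A1 \<subseteq> \<Omega> \<and> measure lebesgue A1 \<noteq> 0 \<and>
               (AE x in lebesgue_on \<Omega>. \<phi> x = \<xi> * indicat_real A1 x)))"
proof -
  define M where "M = lebesgue_on \<Omega>"
  have \<Omega>: "\<Omega> \<in> sets lebesgue" "\<Omega> \<in> lmeasurable"
    using assms(1,2) by (auto intro: lmeasurable_open)
  have spM: "space M = \<Omega>" by (simp add: M_def)
  have AE_space_M: "AE x in M. x \<in> \<Omega>" using AE_space[of M] by (simp add: spM)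
  interpret M: finite_measure M
    unfolding M_def using \<Omega>(2) by (rule finite_measure_lebesgue_on)
  obtain g' where g': "\<And>y. (g has_real_derivative g' y) (at y)" "continuous_on UNIV g'"
    using C1_differentiable_on_UNIV_realD[OF assms(5)] by blast
  obtain p' where p': "\<And>y. (p has_real_derivative p' y) (at y)" "continuous_on UNIV p'"
    using C1_differentiable_on_UNIV_realD[OF assms(3)] by blast
  have "{t. 0 \<le> t \<and> ereal t < \<infinity>} = {0..}" by auto
  note sol = assms(11)[unfolded solution_P_def Let_def this, folded M_def]
  interpret nonlocal_flow M u g g' p p'
    using sol g' p' assms(4)
    by unfold_locales (auto simp: C1_Linf_def nonlocal_F_def[abs_def] M_def)
  have u0: "AE x in M. u 0 x = u0 x" using sol by blast
  obtain t where phi: "integrable M \<phi>" "\<And>n. 0 \<le> t n" "filterlim t at_top sequentially"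
    "(\<lambda>n. LINT x|M. \<bar>u (t n) x - \<phi> x\<bar>) \<longlonglongrightarrow> 0"
    using assms(12) by (auto simp: omega_limit_def M_def)
  have level: "{x \<in> \<Omega>. \<phi> x = r} \<in> sets lebesgue" for r
    using phi(1) \<Omega>(1) unfolding M_def by (intro sets_level) auto
  have level_pos: "measure lebesgue {x \<in> \<Omega>. \<phi> x = r} \<noteq> 0" if "\<not> (AE x in M. \<phi> x \<noteq> r)" for r
    using that AE_not_level[OF \<Omega>(1) level assms(2)] unfolding M_def by blast
  \<comment> \<open>On a null space every integral is 0, contrary to nondegeneracy at time 0. This
    makes the essential bounds of \<open>u0\<close> real numbers.\<close>
  have nonnull: "emeasure M (space M) \<noteq> 0"
  proof
    assume "emeasure M (space M) = 0"
    then have "AE x in M. g (u 0 x) = 0" by (rule emeasure_0_AE)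
    then have "(LINT x|M. g (u 0 x)) = 0" by (rule integral_eq_zero_AE)
    with nondegenerate[of 0] show False by simp
  qed
  show ?thesis
  proof (intro conjI impI)
    assume "H1 \<Omega> u0"
    then have H: "u0 \<in> Linf M" "AE x in M. 1 \<le> u0 x" "\<not> (AE x in M. u0 x = 1)"
      unfolding H1_def M_def by auto
    obtain d where d: "esssup M (\<lambda>x. ereal (u0 x)) = ereal d" "AE x in M. u0 x \<le> d"
      using esssup_eq_ereal[OF H(1) nonnull] by blast
    have g_neg: "g y < 0" if "1 * (y - 1) > 0" for y using that assms(9)[of y] by auto
    have init: "AE x in M. 1 * (u 0 x - 1) \<ge> 0" "\<not> (AE x in M. u 0 x = 1)" "AE x in M. 1 * (u 0 x - d) \<le> 0"
    proof -
      show "AE x in M. 1 * (u 0 x - 1) \<ge> 0" using u0 H(2) by eventually_elim auto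
      show "AE x in M. 1 * (u 0 x - d) \<le> 0" using u0 d(2) by eventually_elim auto
      show "\<not> (AE x in M. u 0 x = 1)"
      proof
        assume "AE x in M. u 0 x = 1"
        with u0 have "AE x in M. u0 x = 1" by eventually_elim auto
        with H(3) show False by simp
      qed
    qed
    note lim = one_sided_limit[OF _ assms(7) g_neg init phi]
    show "AE x in lebesgue_on \<Omega>. 1 \<le> \<phi> x \<and>
        ereal (\<phi> x) \<le> esssup (lebesgue_on \<Omega>) (\<lambda>y. ereal (u0 y))"
      using lim(1) d(1) unfolding M_def by simp
    obtain r where r: "r > 1" "AE x in M. \<phi> x = 1 \<or> \<phi> x = r" "\<not> (AE x in M. \<phi> x \<noteq> r)"
      using lim(2) by auto
    let ?A1 = "{x \<in> \<Omega>. \<phi> x = r}"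
    have "AE x in M. \<phi> x = r * indicat_real ?A1 x + indicat_real (\<Omega> - ?A1) x"
      using r(2) AE_space_M by eventually_elim (auto simp: indicator_def)
    then show "\<exists>\<mu> A1. \<mu> > 1 \<and> A1 \<in> sets lebesgue \<and> A1 \<subseteq> \<Omega> \<and> measure lebesgue A1 \<noteq> 0 \<and>
        (AE x in lebesgue_on \<Omega>. \<phi> x = \<mu> * indicat_real A1 x + indicat_real (\<Omega> - A1) x)"
      using r(1) level level_pos[OF r(3)] unfolding M_def
      by (intro exI[of _ r] exI[of _ ?A1]) auto
  next
    assume "H2 \<Omega> g u0"
    then have "AE x in M. 0 \<le> u0 x \<and> u0 x \<le> 1" unfolding H2_def M_def by auto
    with u0 have init: "AE x in M. u 0 x \<in> {0..1}" by eventually_elim auto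
    have lim: "AE x in M. \<phi> x \<in> {0..1}" "\<exists>r. AE x in M. \<phi> x = 0 \<or> \<phi> x = 1 \<or> \<phi> x = r"
      using two_sided_limit[OF assms(6,7) _ init phi] assms(8) by blast+
    show "AE x in lebesgue_on \<Omega>. 0 \<le> \<phi> x \<and> \<phi> x \<le> 1"
      using lim(1) unfolding M_def by simp
    obtain r where r: "AE x in M. \<phi> x = 0 \<or> \<phi> x = 1 \<or> \<phi> x = r" using lim(2) by auto
    \<comment> \<open>If \<open>r\<close> lies outside the open unit interval, \<open>\<phi>\<close>
      takes only the values 0 and 1 almost everywhere; then \<open>1 / 2\<close> is a placeholder
      and \<open>?A2\<close> is a null set.\<close>
    define \<nu> where "\<nu> = (if r \<in> {0<..<1} then r else 1 / 2)"
    let ?A1 = "{x \<in> \<Omega>. \<phi> x = 1}" and ?A2 = "{x \<in> \<Omega>. \<phi> x = \<nu>}"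
    have \<nu>: "0 < \<nu>" "\<nu> < 1" by (auto simp: \<nu>_def)
    have "AE x in M. \<phi> x = indicat_real ?A1 x + \<nu> * indicat_real ?A2 x"
      using r lim(1) AE_space_M
      by eventually_elim (auto simp: indicator_def \<nu>_def split: if_splits)
    moreover have "?A1 \<union> ?A2 \<subseteq> \<Omega>" "?A1 \<inter> ?A2 = {}" using \<nu> by auto
    ultimately show "\<exists>\<nu> A1 A2. 0 < \<nu> \<and> \<nu> < 1 \<and> A1 \<in> sets lebesgue \<and> A2 \<in> sets lebesgue \<and>
        A1 \<union> A2 \<subseteq> \<Omega> \<and> A1 \<inter> A2 = {} \<and>
        (AE x in lebesgue_on \<Omega>. \<phi> x = indicat_real A1 x + \<nu> * indicat_real A2 x)"
      using \<nu> level unfolding M_def by blast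
  next
    assume "H3 \<Omega> u0"
    then have H: "u0 \<in> Linf M" "AE x in M. u0 x \<le> 0" "\<not> (AE x in M. u0 x = 0)"
      unfolding H3_def M_def by auto
    obtain d where d: "essinf M (\<lambda>x. ereal (u0 x)) = ereal d" "AE x in M. d \<le> u0 x"
      using essinf_eq_ereal[OF H(1) nonnull] by blast
    have g_neg: "g y < 0" if "(- 1) * (y - 0) > 0" for y using that assms(9)[of y] by auto
    have init: "AE x in M. (- 1) * (u 0 x - 0) \<ge> 0" "\<not> (AE x in M. u 0 x = 0)"
      "AE x in M. (- 1) * (u 0 x - d) \<le> 0"
    proof -
      show "AE x in M. (- 1) * (u 0 x - 0) \<ge> 0" using u0 H(2) by eventually_elim auto
      show "AE x in M. (- 1) * (u 0 x - d) \<le> 0" using u0 d(2) by eventually_elim auto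
      show "\<not> (AE x in M. u 0 x = 0)"
      proof
        assume "AE x in M. u 0 x = 0"
        with u0 have "AE x in M. u0 x = 0" by eventually_elim auto
        with H(3) show False by simp
      qed
    qed
    note lim = one_sided_limit[OF _ assms(6) g_neg init phi]
    show "AE x in lebesgue_on \<Omega>.
        essinf (lebesgue_on \<Omega>) (\<lambda>y. ereal (u0 y)) \<le> ereal (\<phi> x) \<and> \<phi> x \<le> 0"
      using lim(1) d(1) unfolding M_def by (simp add: conj_commute)
    obtain r where r: "r < 0" "AE x in M. \<phi> x = 0 \<or> \<phi> x = r" "\<not> (AE x in M. \<phi> x \<noteq> r)"
      using lim(2) by auto
    let ?A1 = "{x \<in> \<Omega>. \<phi> x = r}"
    have "AE x in M. \<phi> x = r * indicat_real ?A1 x"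
      using r(2) AE_space_M by eventually_elim (auto simp: indicator_def)
    then show "\<exists>\<xi> A1. \<xi> < 0 \<and> A1 \<in> sets lebesgue \<and> A1 \<subseteq> \<Omega> \<and> measure lebesgue A1 \<noteq> 0 \<and>
        (AE x in lebesgue_on \<Omega>. \<phi> x = \<xi> * indicat_real A1 x)"
      using r(1) level level_pos[OF r(3)] unfolding M_def
      by (intro exI[of _ r] exI[of _ ?A1]) auto
  qed
qed

end
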